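(* Consider the MYOPIC algorithm on the sparse bipartite stochastic block model described in the context. For each class $c\in\{1,\dots,C\}$ let $y_c:[0,\alpha]\to\mathbb{R}$ be the solution of $$\dot y_c(s)=\sum_{d=1}^{D}\Bigl(1-e^{-a_{c,d}(b_c-y_c(s))}\Bigr)Q^*(c,d),\qquad y_c(0)=0,$$ and let $L_c=\sum_{d=1}^D a_{c,d}Q^*(c,d)$ and $J_c=\frac{b_c^2}{2}\sum_{d=1}^{D}a_{c,d}^2Q^*(c,d)$. (i) For each class $c$, with probability at least $1-2C\exp\bigl(-N^{1/3}L_c^2/(8\alpha)\bigr)$, the number $M_c(t)$ of matched offline nodes of class $c$ satisfies, for all $t\in\{1,\dots,T\}$, $$\left|\frac{M_c(t)}{N}-y_c(t/N)\right|\le \frac{3L_ce^{\alpha L_c}}{N^{1/3}}.$$ (ii) For each class $c$ and all $t\in[0,\alpha]$, one has $y_c(t)=\tilde y_c(t)-e_c(t)$, where $\tilde y_c(t)=b_c-b_c e^{-tL_c}$, $e_c(0)=0$, and $$e_c(t)\le\frac{J_c}{L_c}\bigl(1-e^{-L_ct}\bigr)$$ (the right-hand side being read as $0$ if $L_c=0$, in which case $J_c=0$ as well).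
   Context: Model. $N,T,C,D\ge 1$ are integers and $\alpha>0$ satisfies $T=\alpha N$. There are $N$ offline nodes, each with a class in $\{1,\dots,C\}$; $b_c$ is the proportion of offline nodes of class $c$ (so class $c$ has $Nb_c$ nodes). The offline classes are regarded as given. Online nodes $t=1,\dots,T$ arrive sequentially; the class $d(t)\in\{1,\dots,D\}$ of node $t$ is drawn independently from a probability distribution $\nu$ on $\{1,\dots,D\}$. Given all classes, each edge between an offline node of class $c$ and an online node of class $d$ is present independently with probability $p(c,d)=a_{c,d}/N$, where $0\le a_{c,d}\le a$ for a fixed constant $a\in(0,N)$. The edges incident to $t$ are revealed only when $t$ arrives. Each node can be matched at most once and decisions are irrevocable. $\mathcal F_c(t)$ denotes the set of offline nodes of class $c$ that are unmatched when $t$ arrives and are adjacent to $t$. $M_c(t)$ denotes the number of offline nodes of class $c$ matched before vertex $t$ arrives. MYOPIC algorithm. Let $Q^*$ be an optimal transport plan between $\nu$ and $b=(b_c)_c$ for the cost $-p(c,d)$, i.e. a maximizer of $\sum_{c,d}Q(c,d)p(c,d)$ over nonnegative matrices $Q$ with $\sum_d Q(c,d)=b_c$ for all $c$ and $\sum_c Q(c,d)=\nu(d)$ for all $d$. When node $t$ of class $d(t)$ arrives, choose a class $c_t$ at random, equal to $c$ with probability $Q^*(c,d(t))/\nu(d(t))$. If $\mathcal F_{c_t}(t)=\emptyset$, node $t$ is left unmatched; otherwise $t$ is matched to a uniformly random node of $\mathcal F_{c_t}(t)$. Probabilities are over the online classes, the edges and the algorithm's randomness. *)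

theory Defs
  imports "HOL-Probability.Probability"
begin

text \<open>
  Offline nodes are \<open>{1..N}\<close>, online nodes \<open>{1..T}\<close>, offline classes \<open>{1..C}\<close> and online
  classes \<open>{1..D}\<close>.  The given classes of the offline nodes are a function \<open>cls\<close>, and \<open>\<nu>\<close> is
  a \<open>pmf\<close> on \<open>nat\<close> supported in \<open>{1..D}\<close>.  Values of \<open>a\<close>, \<open>Q\<close>, \<open>cls\<close> outside these index
  sets are irrelevant.
\<close>

definition class_prop :: "nat \<Rightarrow> (nat \<Rightarrow> nat) \<Rightarrow> nat \<Rightarrow> real" where
  "class_prop N cls c = real (card {u \<in> {1..N}. cls u = c}) / real N"

definition edge_prob :: "nat \<Rightarrow> (nat \<Rightarrow> nat \<Rightarrow> real) \<Rightarrow> nat \<Rightarrow> nat \<Rightarrow> real" where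
  "edge_prob N a c d = a c d / real N"

definition transport_plans ::
    "nat \<Rightarrow> nat \<Rightarrow> (nat \<Rightarrow> real) \<Rightarrow> nat pmf \<Rightarrow> (nat \<Rightarrow> nat \<Rightarrow> real) set" where
  "transport_plans C D b \<nu> =
     {Q. (\<forall>c\<in>{1..C}. \<forall>d\<in>{1..D}. 0 \<le> Q c d) \<and>
         (\<forall>c\<in>{1..C}. (\<Sum>d=1..D. Q c d) = b c) \<and>
         (\<forall>d\<in>{1..D}. (\<Sum>c=1..C. Q c d) = pmf \<nu> d)}"

definition optimal_plan ::
    "nat \<Rightarrow> nat \<Rightarrow> (nat \<Rightarrow> real) \<Rightarrow> nat pmf \<Rightarrow> (nat \<Rightarrow> nat \<Rightarrow> real) \<Rightarrow> (nat \<Rightarrow> nat \<Rightarrow> real) \<Rightarrow> bool"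
where
  "optimal_plan C D b \<nu> p Q \<longleftrightarrow>
     is_arg_max (\<lambda>Q. \<Sum>c=1..C. \<Sum>d=1..D. Q c d * p c d) (\<lambda>Q. Q \<in> transport_plans C D b \<nu>) Q"

text \<open>
  Joint law of the online classes and of the graph; \<open>G (u, t)\<close> says that offline node \<open>u\<close> and
  online node \<open>t\<close> are adjacent.  Given the classes, the edges are independent.
\<close>

definition sbm_pmf ::
    "nat \<Rightarrow> nat \<Rightarrow> (nat \<Rightarrow> nat) \<Rightarrow> nat pmf \<Rightarrow> (nat \<Rightarrow> nat \<Rightarrow> real) \<Rightarrow>
     ((nat \<Rightarrow> nat) \<times> (nat \<times> nat \<Rightarrow> bool)) pmf" where
  "sbm_pmf N T cls \<nu> a =
     bind_pmf (Pi_pmf {1..T} 0 (\<lambda>_. \<nu>)) (\<lambda>d.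
     bind_pmf (Pi_pmf ({1..N} \<times> {1..T}) False
                 (\<lambda>(u, t). bernoulli_pmf (edge_prob N a (cls u) (d t)))) (\<lambda>G.
     return_pmf (d, G)))"

text \<open>
  A matching is a partial map \<open>m\<close> from online to offline nodes: \<open>m t = Some u\<close> iff \<open>t\<close> was
  matched to \<open>u\<close>.
\<close>

definition matched_before :: "(nat \<Rightarrow> nat option) \<Rightarrow> nat \<Rightarrow> nat set" where
  "matched_before m t = {u. \<exists>s<t. m s = Some u}"

definition num_matched :: "nat \<Rightarrow> (nat \<Rightarrow> nat) \<Rightarrow> nat \<Rightarrow> nat \<Rightarrow> (nat \<Rightarrow> nat option) \<Rightarrow> nat" where
  "num_matched N cls c t m = card {u \<in> {1..N}. cls u = c \<and> u \<in> matched_before m t}"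

definition free_neighbours ::
    "nat \<Rightarrow> (nat \<Rightarrow> nat) \<Rightarrow> (nat \<times> nat \<Rightarrow> bool) \<Rightarrow> nat \<Rightarrow> nat \<Rightarrow> (nat \<Rightarrow> nat option) \<Rightarrow> nat set"
where
  "free_neighbours N cls G c t m =
     {u \<in> {1..N}. cls u = c \<and> u \<notin> matched_before m t \<and> G (u, t)}"

text \<open>
  The choice of an offline class for an online node of class \<open>d\<close>.  This is meaningful only when
  \<open>pmf \<nu> d > 0\<close>, which holds almost surely for the classes of the online nodes; see
  \<open>pmf_class_choice\<close> below.
\<close>

definition class_choice :: "nat \<Rightarrow> nat pmf \<Rightarrow> (nat \<Rightarrow> nat \<Rightarrow> real) \<Rightarrow> nat \<Rightarrow> nat pmf" where
  "class_choice C \<nu> Q d = embed_pmf (\<lambda>c. if c \<in> {1..C} then Q c d / pmf \<nu> d else 0)"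

lemma pmf_class_choice:
  assumes Q: "Q \<in> transport_plans C D b \<nu>" and d: "d \<in> {1..D}" "d \<in> set_pmf \<nu>"
  shows "pmf (class_choice C \<nu> Q d) c = (if c \<in> {1..C} then Q c d / pmf \<nu> d else 0)"
proof -
  let ?f = "\<lambda>c. if c \<in> {1..C} then Q c d / pmf \<nu> d else 0"
  have pos: "0 < pmf \<nu> d" using d(2) by (simp add: pmf_positive_iff)
  have nn: "0 \<le> ?f c" for c
    using Q d(1) by (auto simp: transport_plans_def)
  have "(\<integral>\<^sup>+c. ennreal (?f c) \<partial>count_space UNIV)
      = (\<integral>\<^sup>+c. ennreal (Q c d / pmf \<nu> d) * indicator {1..C} c \<partial>count_space UNIV)"
    by (intro nn_integral_cong) (auto simp: indicator_def)
  also have "\<dots> = (\<integral>\<^sup>+c. ennreal (Q c d / pmf \<nu> d) \<partial>count_space {1..C})"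
    by (simp add: nn_integral_count_space_indicator)
  also have "\<dots> = (\<Sum>c=1..C. ennreal (Q c d / pmf \<nu> d))"
    by (simp add: nn_integral_count_space_finite)
  also have "\<dots> = ennreal (\<Sum>c=1..C. Q c d / pmf \<nu> d)"
    using Q d(1) by (intro sum_ennreal) (auto simp: transport_plans_def)
  also have "(\<Sum>c=1..C. Q c d / pmf \<nu> d) = 1"
    using Q d(1) pos by (simp add: transport_plans_def flip: sum_divide_distrib)
  finally have "(\<integral>\<^sup>+c. ennreal (?f c) \<partial>count_space UNIV) = 1" by simp
  with nn show ?thesis
    unfolding class_choice_def by (subst pmf_embed_pmf) auto
qed

text \<open>The matching after the arrival of the first \<open>n\<close> online nodes, for given classes and graph.\<close>

primrec myopic_run ::
    "nat \<Rightarrow> nat \<Rightarrow> (nat \<Rightarrow> nat) \<Rightarrow> nat pmf \<Rightarrow> (nat \<Rightarrow> nat \<Rightarrow> real) \<Rightarrow>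
     (nat \<Rightarrow> nat) \<Rightarrow> (nat \<times> nat \<Rightarrow> bool) \<Rightarrow> nat \<Rightarrow> (nat \<Rightarrow> nat option) pmf" where
  "myopic_run N C cls \<nu> Q d G 0 = return_pmf Map.empty"
| "myopic_run N C cls \<nu> Q d G (Suc n) =
     bind_pmf (myopic_run N C cls \<nu> Q d G n) (\<lambda>m.
     bind_pmf (class_choice C \<nu> Q (d (Suc n))) (\<lambda>c.
     let F = free_neighbours N cls G c (Suc n) m in
     if F = {} then return_pmf m
     else map_pmf (\<lambda>u. m(Suc n \<mapsto> u)) (pmf_of_set F)))"

definition myopic_pmf ::
    "nat \<Rightarrow> nat \<Rightarrow> nat \<Rightarrow> (nat \<Rightarrow> nat) \<Rightarrow> nat pmf \<Rightarrow> (nat \<Rightarrow> nat \<Rightarrow> real) \<Rightarrow>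
     (nat \<Rightarrow> nat \<Rightarrow> real) \<Rightarrow> (nat \<Rightarrow> nat option) pmf" where
  "myopic_pmf N T C cls \<nu> a Q =
     bind_pmf (sbm_pmf N T cls \<nu> a) (\<lambda>(d, G). myopic_run N C cls \<nu> Q d G T)"

definition rate_L :: "nat \<Rightarrow> (nat \<Rightarrow> nat \<Rightarrow> real) \<Rightarrow> (nat \<Rightarrow> nat \<Rightarrow> real) \<Rightarrow> nat \<Rightarrow> real" where
  "rate_L D a Q c = (\<Sum>d=1..D. a c d * Q c d)"

definition rate_J ::
    "nat \<Rightarrow> (nat \<Rightarrow> real) \<Rightarrow> (nat \<Rightarrow> nat \<Rightarrow> real) \<Rightarrow> (nat \<Rightarrow> nat \<Rightarrow> real) \<Rightarrow> nat \<Rightarrow> real" where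
  "rate_J D b a Q c = (b c)\<^sup>2 / 2 * (\<Sum>d=1..D. (a c d)\<^sup>2 * Q c d)"

end

theory Submission
  imports Defs
begin

text \<open>
  Fix an offline class \<open>c\<close>.  Revealing the class and the edges of an online node only on its
  arrival makes the number of matched nodes of class \<open>c\<close> a Markov chain on its own, whose upward
  steps have probability \<open>\<Sum>d. Q c d (1 - (1 - a c d / N) ^ (N b c - M))\<close>; the factor \<open>\<nu> d\<close> of
  the class law cancels against the class choice.  This differs from the drift of the differential
  equation by at most \<open>L / (2 N)\<close>, uniformly.  The maximal form of Azuma's inequality bounds the
  martingale part by \<open>\<mu> = L N\<^sup>2\<^sup>/\<^sup>3 / 2\<close> up to the stated probability, and a discrete Gronwall
  argument compares the chain with the solution.  When \<open>L\<close> is so small that the remaining error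
  \<open>1 / (2 N)\<close> is not covered by \<open>L / N\<^sup>1\<^sup>/\<^sup>3\<close>, the claimed probability is nonpositive.
\<close>

subsection \<open>Real inequalities\<close>

text \<open>At interior points the derivative within \<open>{0..h}\<close> is the full derivative;
  continuity takes care of the endpoints, where the derivative may be only one-sided.\<close>

lemma nondecreasing_if_deriv_nonneg_within:
  fixes f f' :: "real \<Rightarrow> real"
  assumes deriv: "\<And>x. x \<in> {0..h} \<Longrightarrow> (f has_real_derivative f' x) (at x within {0..h})"
    and nonneg: "\<And>x. s < x \<Longrightarrow> x < t \<Longrightarrow> 0 \<le> f' x"
    and st: "0 \<le> s" "s \<le> t" "t \<le> h"
  shows "f s \<le> f t"
proof (rule DERIV_nonneg_imp_increasing_open[OF \<open>s \<le> t\<close>])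
  show "\<exists>y. (f has_real_derivative y) (at x) \<and> 0 \<le> y" if "s < x" "x < t" for x
  proof -
    have "x \<in> {0..h}" "x \<in> interior {0..h}" using that st by auto
    with deriv nonneg[OF that] show ?thesis by (metis at_within_interior)
  qed
  have "continuous_on {0..h} f" using deriv by (meson DERIV_continuous_on)
  then show "continuous_on {s..t} f"
    by (rule continuous_on_subset) (use st in auto)
qed

text \<open>A barrier argument: after the last time \<open>r\<close> up to \<open>s\<close> at which
  \<open>w\<close> is nonnegative, \<open>w\<close> stays negative and hence cannot decrease, so
  \<open>w r \<le> w s\<close>, a contradiction. It serves to keep the solution below its capacity
  \<beta>.\<close>

lemma nonneg_if_deriv_nonneg_when_neg:
  fixes w w' :: "real \<Rightarrow> real"
  assumes deriv: "\<And>s. s \<in> {0..h} \<Longrightarrow> (w has_real_derivative w' s) (at s within {0..h})"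
    and neg: "\<And>s. s \<in> {0..h} \<Longrightarrow> w s < 0 \<Longrightarrow> 0 \<le> w' s"
    and "0 \<le> w 0" and s: "s \<in> {0..h}"
  shows "0 \<le> w s"
proof (rule ccontr)
  assume "\<not> 0 \<le> w s"
  then have ws: "w s < 0" by simp
  define S where "S = {0..s} \<inter> w -` {0..}"
  have "continuous_on {0..h} w" using deriv by (meson DERIV_continuous_on)
  then have "continuous_on {0..s} w" by (rule continuous_on_subset) (use s in auto)
  then have "closed S"
    unfolding S_def by (intro continuous_closed_preimage) auto
  then have "compact ({0..s} \<inter> S)" by (intro compact_Int_closed) auto
  moreover have "0 \<in> {0..s} \<inter> S" using s \<open>0 \<le> w 0\<close> by (auto simp: S_def)
  ultimately obtain r where r: "r \<in> {0..s} \<inter> S" "\<And>x. x \<in> {0..s} \<inter> S \<Longrightarrow> x \<le> r"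
    using compact_attains_sup[of "{0..s} \<inter> S"] by blast
  have "w r \<le> w s"
  proof (rule nondecreasing_if_deriv_nonneg_within[OF deriv])
    show "0 \<le> w' x" if "r < x" "x < s" for x
      using r(2)[of x] r(1) that s by (intro neg) (force simp: S_def)+
  qed (use r(1) s in \<open>auto simp: S_def\<close>)
  with r(1) ws show False by (simp add: S_def)
qed

text \<open>The difference of the two sides vanishes at \<open>0\<close> and has derivative
  \<open>exp (- x) - (1 - x)\<close>, which is nonnegative.\<close>

lemma exp_minus_le_quadratic:
  fixes x :: real
  assumes "0 \<le> x"
  shows "exp (- x) \<le> 1 - x + x\<^sup>2 / 2"
proof -
  define f where "f = (\<lambda>x::real. 1 - x + x\<^sup>2 / 2 - exp (- x))"
  have "f 0 \<le> f x"
  proof (rule DERIV_nonneg_imp_nondecreasing[OF assms])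
    show "\<exists>y. (f has_real_derivative y) (at x) \<and> 0 \<le> y" if "0 \<le> x" for x
      using exp_ge_add_one_self[of "- x"] unfolding f_def
      by (intro exI[of _ "- 1 + x + exp (- x)"]) (auto intro!: derivative_eq_intros)
  qed
  then show ?thesis by (simp add: f_def)
qed

text \<open>Uniform in \<open>n\<close>: the factor \<open>n\<close> gained from telescoping is paid for by the exponential decay.\<close>

lemma exp_minus_power_approx:
  fixes \<theta> :: real
  assumes "0 \<le> \<theta>" "\<theta> \<le> 1"
  shows "(1 - \<theta>) ^ n \<le> exp (- \<theta> * real n)" and "exp (- \<theta> * real n) - (1 - \<theta>) ^ n \<le> \<theta> / 2"
proof -
  have base: "1 - \<theta> \<le> exp (- \<theta>)" using exp_ge_add_one_self[of "- \<theta>"] by simp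
  have pow: "exp (- \<theta> * real n) = exp (- \<theta>) ^ n"
    by (simp add: exp_of_nat_mult[symmetric] mult.commute)
  show "(1 - \<theta>) ^ n \<le> exp (- \<theta> * real n)"
    unfolding pow using base assms by (intro power_mono) auto
  show "exp (- \<theta> * real n) - (1 - \<theta>) ^ n \<le> \<theta> / 2"
  proof (cases n)
    case 0
    then show ?thesis using assms by simp
  next
    case (Suc m)
    have "exp (- \<theta>) ^ n - (1 - \<theta>) ^ n
        = (exp (- \<theta>) - (1 - \<theta>)) * (\<Sum>i<n. (1 - \<theta>) ^ (n - Suc i) * exp (- \<theta>) ^ i)"
      by (rule power_diff_sumr2)
    \<comment> \<open>Every summand is a product of \<open>m = n - 1\<close> factors, each at most
      \<open>exp (- \<theta>)\<close>.\<close>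
    also have "\<dots> \<le> (exp (- \<theta>) - (1 - \<theta>)) * (\<Sum>i<n. exp (- \<theta>) ^ m)"
    proof (intro mult_left_mono sum_mono)
      fix i assume "i \<in> {..<n}"
      then have "exp (- \<theta>) ^ m = exp (- \<theta>) ^ (n - Suc i) * exp (- \<theta>) ^ i"
        using Suc by (simp add: power_add[symmetric])
      then show "(1 - \<theta>) ^ (n - Suc i) * exp (- \<theta>) ^ i \<le> exp (- \<theta>) ^ m"
        using base assms by (auto intro!: mult_right_mono power_mono)
    qed (use base in simp)
    also have "\<dots> = (exp (- \<theta>) - (1 - \<theta>)) * (real n * exp (- \<theta> * real m))"
      by (simp add: exp_of_nat_mult[symmetric] mult.commute)
    also have "\<dots> \<le> \<theta>\<^sup>2 / 2 * (real n * exp (- \<theta> * real m))"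
      using exp_minus_le_quadratic[OF assms(1)] by (intro mult_right_mono) auto
    \<comment> \<open>One factor \<theta> is kept for the bound; the other joins \<open>n\<close>,
      and \<open>\<theta> * n \<le> 1 + \<theta> * m \<le> exp (\<theta> * m)\<close> is then
      cancelled by the decay.\<close>
    also have "\<dots> = \<theta> / 2 * ((\<theta> * real n) * exp (- \<theta> * real m))"
      by (simp add: power2_eq_square)
    also have "\<dots> \<le> \<theta> / 2 * 1"
    proof (intro mult_left_mono)
      have "\<theta> * real n \<le> 1 + \<theta> * real m"
        using assms Suc by (simp add: algebra_simps)
      also have "\<dots> \<le> exp (\<theta> * real m)" by (rule exp_ge_add_one_self)
      finally have "\<theta> * real n * exp (- \<theta> * real m) \<le> exp (\<theta> * real m) * exp (- \<theta> * real m)"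
        by (intro mult_right_mono) auto
      also have "\<dots> = 1" by (simp flip: exp_add)
      finally show "\<theta> * real n * exp (- \<theta> * real m) \<le> 1" .
    qed (use assms in auto)
    finally show ?thesis unfolding pow by simp
  qed
qed

text \<open>The bound reproduces itself exactly under the recursion, because \<open>B\<close> times
  the sum of \<open>(1 + B) ^ j\<close> over \<open>j < k\<close> is
  \<open>(1 + B) ^ k - 1\<close>.\<close>

lemma discrete_gronwall:
  fixes E :: "nat \<Rightarrow> real"
  assumes "0 \<le> B" and "\<And>k. k \<le> n \<Longrightarrow> E k \<le> A + B * (\<Sum>j<k. E j)"
  shows "k \<le> n \<Longrightarrow> E k \<le> A * (1 + B) ^ k"
proof (induction k rule: less_induct)
  case (less k)
  have geom: "B * (\<Sum>j<k. (1 + B) ^ j) = (1 + B) ^ k - 1"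
    using power_diff_1_eq[of "1 + B" k] by (simp add: mult.commute)
  have "E k \<le> A + B * (\<Sum>j<k. A * (1 + B) ^ j)"
    using less assms(1) by (intro order_trans[OF assms(2)[OF less.prems]] add_left_mono mult_left_mono sum_mono) auto
  also have "\<dots> = A * (1 + B * (\<Sum>j<k. (1 + B) ^ j))"
    by (simp add: algebra_simps flip: sum_distrib_left)
  finally show ?case by (simp add: geom)
qed

subsection \<open>The differential equation\<close>

text \<open>One offline class in isolation: \<open>r d\<close>, \<open>q d\<close> and \<beta> stand
  for \<open>a c d\<close>, \<open>Q c d\<close> and \<open>b c\<close>. The equations of different
  classes are not coupled, so each class can be treated separately.\<close>

locale fluid_limit =
  fixes D :: nat and r q :: "nat \<Rightarrow> real" and \<beta> :: real
  assumes r_nonneg: "\<And>d. d \<in> {1..D} \<Longrightarrow> 0 \<le> r d"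
    and q_nonneg: "\<And>d. d \<in> {1..D} \<Longrightarrow> 0 \<le> q d"
    and \<beta>_nonneg: "0 \<le> \<beta>" and \<beta>_le_1: "\<beta> \<le> 1"
begin

definition L :: real where "L = (\<Sum>d=1..D. r d * q d)"

definition F :: "real \<Rightarrow> real" where "F x = (\<Sum>d=1..D. (1 - exp (- r d * (\<beta> - x))) * q d)"

lemma L_nonneg: "0 \<le> L"
  unfolding L_def by (intro sum_nonneg mult_nonneg_nonneg r_nonneg q_nonneg)

lemma F_antimono: "x \<le> x' \<Longrightarrow> F x' \<le> F x"
  unfolding F_def by (intro sum_mono mult_right_mono q_nonneg) (auto intro!: mult_left_mono r_nonneg)

lemma F_\<beta>: "F \<beta> = 0"
  by (simp add: F_def)

lemma F_nonneg: "x \<le> \<beta> \<Longrightarrow> 0 \<le> F x"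
  using F_antimono F_\<beta> by metis

text \<open>Below \<beta> the factor \<open>exp (- r d * (\<beta> - x'))\<close> is at most
  \<open>1\<close>, and \<open>1 - exp (- u) \<le> u\<close> supplies the linear term.\<close>

lemma F_diff_le:
  assumes "x \<le> x'" "x' \<le> \<beta>"
  shows "F x - F x' \<le> L * (x' - x)"
proof -
  have "F x - F x' = (\<Sum>d=1..D. (exp (- r d * (\<beta> - x')) - exp (- r d * (\<beta> - x))) * q d)"
    by (simp add: F_def flip: sum_subtractf) (simp add: algebra_simps)
  also have "\<dots> \<le> (\<Sum>d=1..D. (r d * (x' - x)) * q d)"
  proof (intro sum_mono mult_right_mono q_nonneg)
    fix d assume d: "d \<in> {1..D}"
    have "exp (- r d * (\<beta> - x')) - exp (- r d * (\<beta> - x))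
        = exp (- r d * (\<beta> - x')) * (1 - exp (- (r d * (x' - x))))"
      by (simp add: algebra_simps flip: exp_add)
    also have "\<dots> \<le> 1 * (r d * (x' - x))"
    proof (intro mult_mono)
      show "exp (- r d * (\<beta> - x')) \<le> 1" using assms r_nonneg[OF d] by (simp add: mult_nonneg_nonneg)
      show "1 - exp (- (r d * (x' - x))) \<le> r d * (x' - x)"
        using exp_ge_add_one_self[of "- (r d * (x' - x))"] by linarith
    qed (use assms r_nonneg[OF d] in auto)
    finally show "exp (- r d * (\<beta> - x')) - exp (- r d * (\<beta> - x)) \<le> r d * (x' - x)" by simp
  qed
  also have "\<dots> = L * (x' - x)"
    unfolding L_def sum_distrib_right by (intro sum.cong) auto
  finally show ?thesis .
qed

lemma F_lipschitz:
  assumes "x \<le> \<beta>" "x' \<le> \<beta>"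
  shows "\<bar>F x - F x'\<bar> \<le> L * \<bar>x - x'\<bar>"
proof (cases "x \<le> x'")
  case True
  then show ?thesis using F_diff_le[of x x'] F_antimono[of x x'] assms by simp
next
  case False
  then show ?thesis using F_diff_le[of x' x] F_antimono[of x' x] assms by simp
qed

text \<open>The drift vanishes at \<beta>, and the Lipschitz bound between \<open>0\<close> and
  \<beta> costs \<open>L * \<beta>\<close>, where \<beta> is at most \<open>1\<close>.\<close>

lemma F_le_L:
  assumes "0 \<le> x"
  shows "F x \<le> L"
proof -
  have "F x \<le> F 0 - F \<beta>" using F_antimono[OF assms] F_\<beta> by simp
  also have "\<dots> \<le> L * (\<beta> - 0)" by (intro F_diff_le \<beta>_nonneg order_refl)
  also have "\<dots> \<le> L" using L_nonneg \<beta>_le_1 by (simp add: mult_left_le)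
  finally show ?thesis .
qed

text \<open>A second-order bound for each exponential, with \<open>\<beta> - x \<le> \<beta>\<close>
  in the remainder; the right-hand side is the constant \<open>J\<close> of the theorem.\<close>

lemma linearized_minus_F_le:
  assumes "0 \<le> x" "x \<le> \<beta>"
  shows "L * (\<beta> - x) - F x \<le> \<beta>\<^sup>2 / 2 * (\<Sum>d=1..D. (r d)\<^sup>2 * q d)"
proof -
  have "L * (\<beta> - x) - F x = (\<Sum>d=1..D. (r d * (\<beta> - x) - 1 + exp (- (r d * (\<beta> - x)))) * q d)"
    unfolding L_def F_def sum_distrib_right sum_subtractf[symmetric]
    by (intro sum.cong) (auto simp: algebra_simps)
  also have "\<dots> \<le> (\<Sum>d=1..D. (\<beta>\<^sup>2 / 2 * (r d)\<^sup>2) * q d)"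
  proof (intro sum_mono mult_right_mono q_nonneg)
    fix d assume d: "d \<in> {1..D}"
    have "r d * (\<beta> - x) - 1 + exp (- (r d * (\<beta> - x))) \<le> (r d * (\<beta> - x))\<^sup>2 / 2"
      using exp_minus_le_quadratic[of "r d * (\<beta> - x)"] r_nonneg[OF d] assms by simp
    also have "\<dots> \<le> (r d * \<beta>)\<^sup>2 / 2"
      using r_nonneg[OF d] assms by (intro divide_right_mono power_mono mult_left_mono) auto
    finally show "r d * (\<beta> - x) - 1 + exp (- (r d * (\<beta> - x))) \<le> \<beta>\<^sup>2 / 2 * (r d)\<^sup>2"
      by (simp add: power_mult_distrib mult.commute)
  qed
  also have "\<dots> = \<beta>\<^sup>2 / 2 * (\<Sum>d=1..D. (r d)\<^sup>2 * q d)"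
    by (simp add: sum_distrib_left mult.assoc)
  finally show ?thesis .
qed

end

section \<open>A given solution of the equation and its linearization\<close>

locale fluid_solution = fluid_limit +
  fixes \<alpha> :: real and y :: "real \<Rightarrow> real"
  assumes \<alpha>_pos: "0 < \<alpha>" and y_0: "y 0 = 0"
    and y_deriv: "\<And>s. s \<in> {0..\<alpha>} \<Longrightarrow> (y has_real_derivative F (y s)) (at s within {0..\<alpha>})"
begin

text \<open>Above \<beta> the drift is nonpositive, so the barrier argument applies to
  \<open>\<beta> - y\<close>.\<close>

lemma y_le_\<beta>:
  assumes "s \<in> {0..\<alpha>}"
  shows "y s \<le> \<beta>"
proof -
  have "0 \<le> \<beta> - y s"
  proof (rule nonneg_if_deriv_nonneg_when_neg[where w = "\<lambda>s. \<beta> - y s" and w' = "\<lambda>s. - F (y s)"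
        and h = \<alpha>])
    show "((\<lambda>s. \<beta> - y s) has_real_derivative - F (y s)) (at s within {0..\<alpha>})"
      if "s \<in> {0..\<alpha>}" for s
      using y_deriv[OF that] by (auto intro!: derivative_eq_intros)
    show "0 \<le> - F (y s)" if "\<beta> - y s < 0" for s
      using F_antimono[of \<beta> "y s"] F_\<beta> that by simp
  qed (use assms y_0 \<beta>_nonneg in auto)
  then show ?thesis by simp
qed

lemma y_mono: "0 \<le> s \<Longrightarrow> s \<le> t \<Longrightarrow> t \<le> \<alpha> \<Longrightarrow> y s \<le> y t"
  by (rule nondecreasing_if_deriv_nonneg_within[OF y_deriv]) (auto intro!: F_nonneg y_le_\<beta>)

lemma y_nonneg: "s \<in> {0..\<alpha>} \<Longrightarrow> 0 \<le> y s"
  using y_mono[of 0 s] y_0 by auto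

text \<open>By the mean value theorem the increment is \<open>(t - s) * F (y \<xi>)\<close>, and
  \<open>F (y \<xi>)\<close> lies between the drifts at the two endpoints because \<open>y\<close>
  increases and \<open>F\<close> decreases.\<close>

lemma y_increment:
  assumes "0 \<le> s" "s \<le> t" "t \<le> \<alpha>"
  shows "(t - s) * F (y t) \<le> y t - y s" and "y t - y s \<le> (t - s) * F (y s)"
proof -
  have "\<exists>\<xi>. s \<le> \<xi> \<and> \<xi> \<le> t \<and> y t - y s = (t - s) * F (y \<xi>)"
  proof (cases "s < t")
    case True
    have "continuous_on {0..\<alpha>} y" using y_deriv by (meson DERIV_continuous_on)
    then have "continuous_on {s..t} y"
      by (rule continuous_on_subset) (use assms in auto)
    moreover have "(y has_real_derivative F (y x)) (at x)" if "s < x" "x < t" for x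
    proof -
      have "x \<in> {0..\<alpha>}" "x \<in> interior {0..\<alpha>}" using that assms by auto
      with y_deriv show ?thesis by (metis at_within_interior)
    qed
    ultimately obtain \<xi> where "s < \<xi>" "\<xi> < t" "y t - y s = (t - s) * F (y \<xi>)"
      using MVT[OF True, of y] DERIV_unique
      by (smt (verit, ccfv_threshold) real_differentiable_def)
    then show ?thesis by (auto intro: less_imp_le)
  qed (use assms in auto)
  then obtain \<xi> where \<xi>: "s \<le> \<xi>" "\<xi> \<le> t" "y t - y s = (t - s) * F (y \<xi>)" by blast
  have "F (y t) \<le> F (y \<xi>)" "F (y \<xi>) \<le> F (y s)"
    using \<xi> assms by (auto intro!: F_antimono y_mono)
  then show "(t - s) * F (y t) \<le> y t - y s" "y t - y s \<le> (t - s) * F (y s)"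
    using assms by (auto simp: \<xi>(3) intro!: mult_left_mono)
qed

text \<open>Write \<open>e\<close> for the left-hand side as a function of \<open>t\<close>. Its
  derivative is \<open>L * (\<beta> - y) - F y - L * e\<close>, which is at most
  \<open>J - L * e\<close>; the integrating factor \<open>exp (L * t)\<close> solves this
  inequality.\<close>

lemma linearization_error_le:
  assumes t: "t \<in> {0..\<alpha>}" and "L \<noteq> 0"
  defines "J \<equiv> \<beta>\<^sup>2 / 2 * (\<Sum>d=1..D. (r d)\<^sup>2 * q d)"
  shows "(\<beta> - \<beta> * exp (- t * L)) - y t \<le> J / L * (1 - exp (- L * t))"
proof -
  \<comment> \<open>\<open>h\<close> is \<open>exp (L t)\<close> times the difference of the two sides.\<close>
  define h where "h = (\<lambda>t. J / L * (exp (L * t) - 1) - \<beta> * (exp (L * t) - 1) + y t * exp (L * t))"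
  have "h 0 \<le> h t"
  proof (rule nondecreasing_if_deriv_nonneg_within[where f = h and h = \<alpha>])
    show "(h has_real_derivative (J - (L * (\<beta> - y s) - F (y s))) * exp (L * s)) (at s within {0..\<alpha>})"
      if s: "s \<in> {0..\<alpha>}" for s unfolding h_def using \<open>L \<noteq> 0\<close>
      by (auto intro!: derivative_eq_intros y_deriv[OF s] simp: field_simps)
    show "0 \<le> (J - (L * (\<beta> - y s) - F (y s))) * exp (L * s)" if "0 < s" "s < t" for s
      using that t linearized_minus_F_le[of "y s"] y_le_\<beta> y_nonneg by (simp add: J_def)
  qed (use t in auto)
  \<comment> \<open>Stated for arbitrary reals so that the product \<open>E * x\<close> stays
    visible and can be replaced by \<open>1\<close> for \<open>E = exp (L * t)\<close> and
    \<open>x = exp (- L * t)\<close>.\<close>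
  have alg: "(j * (E - 1) - b * (E - 1) + z * E) * x = j * (E * x - x) - b * (E * x - x) + z * (E * x)"
    for j E b z x :: real
    by (simp add: algebra_simps)
  have "0 \<le> h t * exp (- L * t)" using \<open>h 0 \<le> h t\<close> by (simp add: h_def y_0)
  also have "\<dots> = J / L * (exp (L * t) * exp (- L * t) - exp (- L * t))
      - \<beta> * (exp (L * t) * exp (- L * t) - exp (- L * t)) + y t * (exp (L * t) * exp (- L * t))"
    unfolding h_def by (rule alg)
  also have "exp (L * t) * exp (- L * t) = 1" by (simp flip: exp_add)
  finally show ?thesis by (simp add: algebra_simps)
qed

lemma y_eq_0_if_L_eq_0:
  assumes "L = 0" "t \<in> {0..\<alpha>}"
  shows "y t = 0"
  using y_increment(2)[of 0 t] F_le_L[of 0] F_nonneg[OF \<beta>_nonneg] assms y_nonneg[of t] y_0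
  by auto

end

text \<open>The probability that the next arrival is matched into a class with \<open>n\<close>
  nodes of which \<open>m\<close> are taken: \<open>q d\<close> is the joint weight of online class
  \<open>d\<close> and the choice of this offline class, and the power is the probability that none
  of the \<open>n - m\<close> free nodes is adjacent.\<close>

definition match_prob :: "nat \<Rightarrow> nat \<Rightarrow> (nat \<Rightarrow> real) \<Rightarrow> (nat \<Rightarrow> real) \<Rightarrow> nat \<Rightarrow> nat \<Rightarrow> real" where
  "match_prob N D r q n m = (\<Sum>d=1..D. q d * (1 - (1 - r d / real N) ^ (n - m)))"

text \<open>Since \<open>\<beta> - m / N = (n - m) / N\<close>, each exponential in \<open>F\<close>
  has exponent \<open>- \<theta> * (n - m)\<close> with \<open>\<theta> = r d / N \<le> 1\<close>.
  It differs from the power by at most \<open>\<theta> / 2\<close>, whatever \<open>m\<close>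
  is.\<close>

lemma (in fluid_limit) match_prob_approx:
  assumes N: "0 < N" and n: "real n = \<beta> * real N" and "m \<le> n"
    and r_le: "\<And>d. d \<in> {1..D} \<Longrightarrow> r d \<le> real N"
  shows "\<bar>match_prob N D r q n m - F (real m / real N)\<bar> \<le> L / (2 * real N)"
proof -
  define e where "e = (\<lambda>d. exp (- r d * (\<beta> - real m / real N)) - (1 - r d / real N) ^ (n - m))"
  have e: "0 \<le> e d \<and> e d \<le> r d / (2 * real N)" if d: "d \<in> {1..D}" for d
  proof -
    have "- r d * (\<beta> - real m / real N) = - (r d / real N) * real (n - m)"
      using n N \<open>m \<le> n\<close> by (simp add: of_nat_diff field_simps)
    then show ?thesis
      using exp_minus_power_approx[of "r d / real N" "n - m"] r_nonneg[OF d] r_le[OF d] N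
      by (simp add: e_def)
  qed
  have "match_prob N D r q n m - F (real m / real N) = (\<Sum>d=1..D. e d * q d)"
    unfolding match_prob_def F_def sum_subtractf[symmetric]
    by (intro sum.cong) (auto simp: e_def algebra_simps)
  moreover have "0 \<le> (\<Sum>d=1..D. e d * q d)"
    using e q_nonneg by (intro sum_nonneg) auto
  moreover have "(\<Sum>d=1..D. e d * q d) \<le> (\<Sum>d=1..D. r d / (2 * real N) * q d)"
    using e q_nonneg by (intro sum_mono mult_right_mono) auto
  moreover have "(\<Sum>d=1..D. r d / (2 * real N) * q d) = L / (2 * real N)"
    by (simp add: L_def sum_divide_distrib)
  ultimately show ?thesis by simp
qed

section \<open>Deterministic comparison of the chain with the solution\<close>

context fluid_solution
begin

text \<open>
  The discretisation error of Euler's method telescopes because the drift is nonincreasing along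
  the solution, so it contributes \<open>L / N\<close> independently of \<open>k\<close>.
\<close>

lemma euler_error:
  assumes N: "0 < N" and k: "real k \<le> \<alpha> * real N"
  shows "\<bar>(\<Sum>j<k. F (y (real j / real N))) / real N - y (real k / real N)\<bar> \<le> L / real N"
proof -
  let ?y = "\<lambda>j. y (real j / real N)"
  \<comment> \<open>The error of one Euler step is nonnegative and at most \<open>1 / N\<close>
    times the drop of the drift over that step.\<close>
  have step: "0 \<le> F (?y j) / real N - (?y (Suc j) - ?y j)"
    "F (?y j) / real N - (?y (Suc j) - ?y j) \<le> F (?y j) / real N - F (?y (Suc j)) / real N"
    if "j < k" for j
  proof -
    have le: "real (Suc j) / real N \<le> \<alpha>"
      using that k N by (simp add: field_simps)
    have "real (Suc j) / real N - real j / real N = 1 / real N"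
      by (simp add: add_divide_distrib)
    with y_increment[of "real j / real N" "real (Suc j) / real N"] le
    show "0 \<le> F (?y j) / real N - (?y (Suc j) - ?y j)"
      "F (?y j) / real N - (?y (Suc j) - ?y j) \<le> F (?y j) / real N - F (?y (Suc j)) / real N"
      by (simp_all add: divide_right_mono)
  qed
  have "(\<Sum>j<k. F (?y j)) / real N - ?y k = (\<Sum>j<k. F (?y j) / real N - (?y (Suc j) - ?y j))"
  proof -
    have "(\<Sum>j<k. F (?y j) / real N - (?y (Suc j) - ?y j))
        = (\<Sum>j<k. F (?y j) / real N) - (\<Sum>j<k. ?y (Suc j) - ?y j)"
      by (rule sum_subtractf)
    also have "(\<Sum>j<k. ?y (Suc j) - ?y j) = ?y k - ?y 0"
      by (rule sum_lessThan_telescope)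
    finally show ?thesis by (simp add: y_0 sum_divide_distrib)
  qed
  moreover have "0 \<le> (\<Sum>j<k. F (?y j) / real N - (?y (Suc j) - ?y j))"
    using step by (intro sum_nonneg) auto
  moreover have "(\<Sum>j<k. F (?y j) / real N - (?y (Suc j) - ?y j))
      \<le> (\<Sum>j<k. F (?y j) / real N - F (?y (Suc j)) / real N)"
    using step by (intro sum_mono) auto
  moreover have "(\<Sum>j<k. F (?y j) / real N - F (?y (Suc j)) / real N) \<le> L / real N"
  proof -
    have "(\<Sum>j<k. F (?y j) / real N - F (?y (Suc j)) / real N) = (F (?y 0) - F (?y k)) / real N"
      by (subst sum_lessThan_telescope') (simp add: diff_divide_distrib)
    also have "\<dots> \<le> L / real N"
    proof (intro divide_right_mono)
      have "real k / real N \<in> {0..\<alpha>}" using k N by (simp add: field_simps)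
      then have "0 \<le> F (?y k)" by (intro F_nonneg y_le_\<beta>)
      then show "F (?y 0) - F (?y k) \<le> L" using F_le_L[of 0] by (simp add: y_0)
    qed simp
    finally show ?thesis .
  qed
  ultimately show ?thesis by simp
qed

text \<open>Here \<open>M k\<close> is the count after \<open>k\<close> arrivals, hence the one seen
  by node \<open>Suc k\<close>, and it is compared with \<open>y\<close> at
  \<open>Suc k / N\<close>. This index shift costs one more \<open>L / N\<close>, besides the
  \<open>L / N\<close> of Euler's method.\<close>

lemma chain_tracks_solution:
  fixes M :: "nat \<Rightarrow> nat"
  assumes N: "0 < N" and T: "real T = \<alpha> * real N" and n: "real n = \<beta> * real N"
    and M_le: "\<And>k. M k \<le> n" and L: "0 < L"
    and r_le: "\<And>d. d \<in> {1..D} \<Longrightarrow> r d \<le> real N"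
    and dev: "\<And>k. k < T \<Longrightarrow> \<bar>real (M k) - (\<Sum>j<k. match_prob N D r q n (M j))\<bar> \<le> \<mu>"
    and k: "k < T"
  shows "\<bar>real (M k) / real N - y (real (Suc k) / real N)\<bar>
    \<le> (\<mu> / real N + 2 * L / real N + 1 / (2 * real N)) * exp (\<alpha> * L)"
proof -
  let ?N = "real N"
  define x where "x = (\<lambda>k. real (M k) / ?N)"
  define z where "z = (\<lambda>k. y (real k / ?N))"
  define A where "A = \<mu> / ?N + L / ?N + 1 / (2 * ?N)"
  \<comment> \<open>The shift by \<open>1 / (2 N)\<close> absorbs the drift error \<open>L / (2 N)\<close> per unit of time into Gronwall's
      inequality, so that no factor \<open>\<alpha>\<close> appears outside the exponential.\<close>
  define E where "E = (\<lambda>k. \<bar>x k - z k\<bar> + 1 / (2 * ?N))"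
  have \<mu>: "0 \<le> \<mu>" using dev[OF k] by linarith
  have x_le: "x j \<le> \<beta>" for j
    using M_le[of j] n N by (simp add: x_def field_simps flip: of_nat_le_iff[where 'a = real])
  have z_le: "z j \<le> \<beta>" if "j < T" for j
  proof -
    have "real j / ?N \<in> {0..\<alpha>}" using that T N by (simp add: field_simps)
    then show ?thesis unfolding z_def by (rule y_le_\<beta>)
  qed
  have E_rec: "E i \<le> A + L / ?N * (\<Sum>j<i. E j)" if "i < T" for i
  proof -
    let ?Z = "real (M i) - (\<Sum>j<i. match_prob N D r q n (M j))"
    \<comment> \<open>The error splits into the martingale part \<open>?Z\<close>, the drift
      approximation \<open>e1\<close>, the Lipschitz term \<open>e2\<close> that feeds Gronwall's
      inequality, and the Euler error \<open>e3\<close>.\<close>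
    define e1 e2 e3 where "e1 = (\<Sum>j<i. match_prob N D r q n (M j) - F (x j))"
      and "e2 = (\<Sum>j<i. F (x j) - F (z j))" and "e3 = (\<Sum>j<i. F (z j)) / ?N - z i"
    have "x i - z i = ?Z / ?N + e1 / ?N + e2 / ?N + e3"
      by (simp add: x_def e1_def e2_def e3_def sum_subtractf diff_divide_distrib)
    then have "\<bar>x i - z i\<bar> \<le> \<bar>?Z / ?N\<bar> + \<bar>e1 / ?N\<bar> + \<bar>e2 / ?N\<bar> + \<bar>e3\<bar>"
      by linarith
    also have "\<dots> = \<bar>?Z\<bar> / ?N + \<bar>e1\<bar> / ?N + \<bar>e2\<bar> / ?N + \<bar>e3\<bar>"
      by (simp add: abs_divide)
    also have "\<dots> \<le> \<mu> / ?N + (\<Sum>j<i. L / (2 * ?N)) / ?N + (\<Sum>j<i. L * \<bar>x j - z j\<bar>) / ?N + L / ?N"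
    proof (intro add_mono divide_right_mono)
      show "\<bar>?Z\<bar> \<le> \<mu>" by (rule dev[OF that])
      show "\<bar>e1\<bar> \<le> (\<Sum>j<i. L / (2 * ?N))"
        unfolding e1_def x_def
        by (intro order_trans[OF sum_abs] sum_mono match_prob_approx N n M_le r_le)
      show "\<bar>e2\<bar> \<le> (\<Sum>j<i. L * \<bar>x j - z j\<bar>)"
        unfolding e2_def using that by (intro order_trans[OF sum_abs] sum_mono F_lipschitz x_le z_le) auto
      have "real i \<le> \<alpha> * ?N" using that by (simp flip: T)
      then show "\<bar>e3\<bar> \<le> L / ?N"
        unfolding e3_def z_def by (rule euler_error[OF N])
    qed simp_all
    also have "\<dots> = \<mu> / ?N + L / ?N + L / ?N * (\<Sum>j<i. E j)"
    proof -
      have "L / ?N * (\<Sum>j<i. E j) = (\<Sum>j<i. L * E j) / ?N" by (simp flip: sum_distrib_left)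
      also have "(\<Sum>j<i. L * E j) = (\<Sum>j<i. L / (2 * ?N)) + (\<Sum>j<i. L * \<bar>x j - z j\<bar>)"
        by (simp add: E_def distrib_left sum.distrib)
      finally show ?thesis by (simp add: add_divide_distrib)
    qed
    finally show ?thesis by (simp add: E_def A_def)
  qed
  have "E k \<le> A * (1 + L / ?N) ^ k"
    using k by (intro discrete_gronwall[of _ k] E_rec) (use L in auto)
  also have "\<dots> \<le> A * exp (\<alpha> * L)"
  proof (rule mult_left_mono)
    have "(1 + L / ?N) ^ k \<le> exp (L / ?N) ^ k"
      using L by (intro power_mono) (auto intro: exp_ge_add_one_self)
    also have "\<dots> = exp (real k * (L / ?N))" by (rule exp_of_nat_mult[symmetric])
    also have "\<dots> \<le> exp (\<alpha> * L)"
    proof -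
      have "real k * L \<le> (\<alpha> * ?N) * L" using k L by (intro mult_right_mono) (auto simp flip: T)
      then show ?thesis using N by (simp add: field_simps)
    qed
    finally show "(1 + L / ?N) ^ k \<le> exp (\<alpha> * L)" .
  qed (use \<mu> L in \<open>simp add: A_def\<close>)
  finally have "\<bar>x k - z k\<bar> + 1 / (2 * ?N) \<le> A * exp (\<alpha> * L)" by (simp only: E_def)
  moreover have "0 \<le> 1 / (2 * ?N)" by simp
  ultimately have "\<bar>x k - z k\<bar> \<le> A * exp (\<alpha> * L)" by linarith
  moreover have "\<bar>z k - z (Suc k)\<bar> \<le> L / ?N * exp (\<alpha> * L)"
  proof -
    have le: "real (Suc k) / ?N \<le> \<alpha>" using k T N by (simp add: field_simps)
    have "real (Suc k) / ?N - real k / ?N = 1 / ?N" by (simp add: add_divide_distrib)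
    with y_increment[of "real k / ?N" "real (Suc k) / ?N"] le N
    have "z (Suc k) - z k \<le> F (z k) / ?N" by (simp add: z_def divide_right_mono)
    also have "\<dots> \<le> L / ?N"
      unfolding z_def using k T N
      by (intro divide_right_mono F_le_L y_nonneg) (auto simp: field_simps)
    also have "\<dots> \<le> L / ?N * exp (\<alpha> * L)"
      using mult_left_mono[of 1 "exp (\<alpha> * L)" "L / ?N"] L \<alpha>_pos by simp
    finally have "z (Suc k) - z k \<le> L / ?N * exp (\<alpha> * L)" .
    moreover have "z k \<le> z (Suc k)"
      unfolding z_def using le by (intro y_mono) (auto simp: divide_right_mono)
    ultimately show ?thesis by simp
  qed
  ultimately have "\<bar>x k - z (Suc k)\<bar> \<le> A * exp (\<alpha> * L) + L / ?N * exp (\<alpha> * L)"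
    by linarith
  also have "\<dots> = (\<mu> / ?N + 2 * L / ?N + 1 / (2 * ?N)) * exp (\<alpha> * L)"
    by (simp add: A_def algebra_simps)
  finally show ?thesis by (simp add: x_def z_def)
qed

end

subsection \<open>Maximal inequalities for chains of distributions\<close>

text \<open>Hoeffding's lemma for a centred Bernoulli variable. For negative \<open>s\<close>,
  success and failure are exchanged: \<open>- s\<close> and \<open>1 - p\<close> give the same
  expression.\<close>

lemma bernoulli_mgf_le:
  fixes p s :: real
  assumes p: "0 \<le> p" "p \<le> 1"
  shows "p * exp (s * (1 - p)) + (1 - p) * exp (- s * p) \<le> exp (s\<^sup>2 / 8)"
proof -
  have nonneg: "p * exp (h * (1 - p)) + (1 - p) * exp (- h * p) \<le> exp (h\<^sup>2 / 8)"
    if "0 \<le> h" "0 \<le> p" "p \<le> 1" for h p :: real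
  proof -
    have pos: "0 < 1 + p * (exp h - 1)" using that by (intro add_pos_nonneg) auto
    have "p * exp (h * (1 - p)) + (1 - p) * exp (- h * p) = exp (- h * p) * (1 + p * (exp h - 1))"
      by (simp add: algebra_simps flip: exp_add)
    also have "\<dots> = exp (- h * p + ln (1 + p * (exp h - 1)))"
      using pos by (subst exp_add) simp
    also have "\<dots> \<le> exp (h\<^sup>2 / 8)"
      using Hoeffdings_lemma_aux[of h p] that by simp
    finally show ?thesis .
  qed
  show ?thesis
  proof (cases "0 \<le> s")
    case True
    then show ?thesis using nonneg p by simp
  next
    case False
    then show ?thesis using nonneg[of "- s" "1 - p"] p by (simp add: algebra_simps)
  qed
qed

text \<open>
  Optional stopping is replaced by freezing the exponential supermartingale at the constant \<open>u\<close>
  once \<open>Z\<close> has crossed the level \<open>\<mu>\<close>.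
\<close>

lemma pmf_chain_maximal_exp:
  fixes P :: "nat \<Rightarrow> 'a pmf" and K :: "nat \<Rightarrow> 'a \<Rightarrow> 'a pmf" and Z :: "nat \<Rightarrow> 'a \<Rightarrow> real"
  assumes P_Suc: "\<And>n. P (Suc n) = bind_pmf (P n) (K n)"
    and Z_0: "\<And>x. x \<in> set_pmf (P 0) \<Longrightarrow> Z 0 x = 0"
    and adapted: "\<And>n k x x'. x \<in> set_pmf (P n) \<Longrightarrow> x' \<in> set_pmf (K n x) \<Longrightarrow> k \<le> n \<Longrightarrow> Z k x' = Z k x"
    and mgf: "\<And>n x. x \<in> set_pmf (P n) \<Longrightarrow>
      (\<integral>\<^sup>+x'. ennreal (exp (s * (Z (Suc n) x' - Z n x))) \<partial>K n x) \<le> ennreal (exp v)"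
    and s: "0 \<le> s" and v: "0 \<le> v" and \<mu>: "0 < \<mu>"
  shows "measure_pmf.prob (P T) {x. \<exists>k\<le>T. \<mu> \<le> Z k x} \<le> exp (- s * \<mu> + real T * v)"
proof -
  \<comment> \<open>A lower bound for \<open>exp (s * Z n x - n * v)\<close> at every time
    \<open>n \<le> T\<close> with \<open>\<mu> \<le> Z n x\<close>, so freezing at \<open>u\<close>
    never raises \<open>W\<close> above the exponential.\<close>
  define u where "u = exp (s * \<mu> - real T * v)"
  define W where "W = (\<lambda>n x. if \<exists>k\<le>n. \<mu> \<le> Z k x then u else exp (s * Z n x - real n * v))"
  have W_le: "(\<integral>\<^sup>+x. ennreal (W n x) \<partial>P n) \<le> 1" if "n \<le> T" for n
    using that
  proof (induction n)
    case 0
    have "W 0 x = 1" if "x \<in> set_pmf (P 0)" for x using \<mu> that by (simp add: W_def Z_0)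
    then have "(\<integral>\<^sup>+x. ennreal (W 0 x) \<partial>P 0) = (\<integral>\<^sup>+x. 1 \<partial>P 0)"
      by (intro nn_integral_cong_AE) (simp add: AE_measure_pmf_iff)
    then show ?case by simp
  next
    case (Suc n)
    \<comment> \<open>The supermartingale property: a frozen value persists because past values of
      \<open>Z\<close> do not change; otherwise the factor \<open>exp (- v)\<close> offsets the
      moment bound.\<close>
    have step: "(\<integral>\<^sup>+x'. ennreal (W (Suc n) x') \<partial>K n x) \<le> ennreal (W n x)"
      if x: "x \<in> set_pmf (P n)" for x
    proof (cases "\<exists>k\<le>n. \<mu> \<le> Z k x")
      case True
      then have "W (Suc n) x' = W n x" if "x' \<in> set_pmf (K n x)" for x'
        using adapted[OF x that] unfolding W_def by (metis le_Suc_eq)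
      then have "(\<integral>\<^sup>+x'. ennreal (W (Suc n) x') \<partial>K n x) = (\<integral>\<^sup>+x'. ennreal (W n x) \<partial>K n x)"
        by (intro nn_integral_cong_AE) (simp add: AE_measure_pmf_iff)
      then show ?thesis by simp
    next
      case False
      have bound: "W (Suc n) x' \<le> exp (s * Z n x - real n * v) * exp (- v) * exp (s * (Z (Suc n) x' - Z n x))"
        if x': "x' \<in> set_pmf (K n x)" for x'
      proof -
        have "W (Suc n) x' \<le> exp (s * Z (Suc n) x' - real (Suc n) * v)"
        proof (cases "\<mu> \<le> Z (Suc n) x'")
          case True
          then have "s * \<mu> \<le> s * Z (Suc n) x'" using s by (rule mult_left_mono)
          moreover have "real (Suc n) * v \<le> real T * v"
            using Suc.prems v by (intro mult_right_mono) auto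
          ultimately have "u \<le> exp (s * Z (Suc n) x' - real (Suc n) * v)"
            unfolding u_def by simp
          then show ?thesis by (simp add: W_def)
        next
          case F: False
          then have "\<not> (\<exists>k\<le>Suc n. \<mu> \<le> Z k x')"
            using False adapted[OF x x'] by (metis le_Suc_eq)
          then show ?thesis unfolding W_def by (simp only: if_False order_refl)
        qed
        then show ?thesis by (simp add: algebra_simps flip: exp_add)
      qed
      have "(\<integral>\<^sup>+x'. ennreal (W (Suc n) x') \<partial>K n x)
          \<le> (\<integral>\<^sup>+x'. ennreal (exp (s * Z n x - real n * v) * exp (- v))
            * ennreal (exp (s * (Z (Suc n) x' - Z n x))) \<partial>K n x)"
        by (intro nn_integral_mono_AE)
           (auto simp: AE_measure_pmf_iff intro!: bound simp flip: ennreal_mult')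
      also have "\<dots> = ennreal (exp (s * Z n x - real n * v) * exp (- v))
          * (\<integral>\<^sup>+x'. ennreal (exp (s * (Z (Suc n) x' - Z n x))) \<partial>K n x)"
        by (rule nn_integral_cmult) simp
      also have "\<dots> \<le> ennreal (exp (s * Z n x - real n * v) * exp (- v)) * ennreal (exp v)"
        by (intro mult_left_mono mgf x) simp
      also have "\<dots> = ennreal (W n x)"
        using False by (auto simp: W_def mult.assoc simp flip: ennreal_mult' exp_add)
      finally show ?thesis .
    qed
    have "(\<integral>\<^sup>+x. ennreal (W (Suc n) x) \<partial>P (Suc n)) = (\<integral>\<^sup>+x. \<integral>\<^sup>+x'. ennreal (W (Suc n) x') \<partial>K n x \<partial>P n)"
      by (simp add: P_Suc)
    also have "\<dots> \<le> (\<integral>\<^sup>+x. ennreal (W n x) \<partial>P n)"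
      by (intro nn_integral_mono_AE) (simp add: AE_measure_pmf_iff step)
    also have "\<dots> \<le> 1" using Suc by simp
    finally show ?case .
  qed
  let ?B = "{x. \<exists>k\<le>T. \<mu> \<le> Z k x}"
  \<comment> \<open>Markov's inequality: \<open>W T\<close> equals \<open>u\<close> on the event and
    is positive elsewhere.\<close>
  have "ennreal (u * measure_pmf.prob (P T) ?B) = (\<integral>\<^sup>+x. ennreal u * indicator ?B x \<partial>P T)"
    by (simp add: nn_integral_cmult measure_pmf.emeasure_eq_measure u_def flip: ennreal_mult')
  also have "\<dots> \<le> (\<integral>\<^sup>+x. ennreal (W T x) \<partial>P T)"
    by (intro nn_integral_mono) (auto simp: W_def indicator_def)
  also have "\<dots> \<le> 1" by (rule W_le) simp
  finally have "u * measure_pmf.prob (P T) ?B \<le> 1" by simp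
  moreover have "1 / u = exp (- s * \<mu> + real T * v)"
    by (simp add: u_def exp_diff exp_add exp_minus field_simps)
  moreover have "0 < u" by (simp add: u_def)
  ultimately show ?thesis by (metis mult.commute pos_le_divide_eq)
qed

text \<open>Subtracting the conditional step probabilities leaves a martingale with centred
  Bernoulli increments; the maximal inequality is applied to it and to its negative. States carry
  their history, so \<open>M k\<close> can be read off any later state.\<close>

lemma pmf_chain_count_deviation:
  fixes P :: "nat \<Rightarrow> 'a pmf" and K :: "nat \<Rightarrow> 'a \<Rightarrow> 'a pmf"
    and M :: "nat \<Rightarrow> 'a \<Rightarrow> nat" and p :: "nat \<Rightarrow> real"
  assumes P_Suc: "\<And>n. P (Suc n) = bind_pmf (P n) (K n)"
    and M_0: "\<And>x. x \<in> set_pmf (P 0) \<Longrightarrow> M 0 x = 0"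
    and adapted: "\<And>n k x x'. x \<in> set_pmf (P n) \<Longrightarrow> x' \<in> set_pmf (K n x) \<Longrightarrow> k \<le> n \<Longrightarrow> M k x' = M k x"
    and step: "\<And>n x. x \<in> set_pmf (P n) \<Longrightarrow>
      map_pmf (M (Suc n)) (K n x) = map_pmf (\<lambda>X. M n x + of_bool X) (bernoulli_pmf (p (M n x)))"
    and p: "\<And>n x. x \<in> set_pmf (P n) \<Longrightarrow> p (M n x) \<in> {0..1}"
    and \<mu>: "0 < \<mu>" and T: "0 < T"
  shows "measure_pmf.prob (P T) {x. \<exists>k\<le>T. \<mu> \<le> \<bar>real (M k x) - (\<Sum>j<k. p (M j x))\<bar>}
    \<le> 2 * exp (- 2 * \<mu>\<^sup>2 / real T)"
proof -
  define Z where "Z = (\<lambda>k x. real (M k x) - (\<Sum>j<k. p (M j x)))"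
  \<comment> \<open>This value minimises \<open>- s * \<mu> + T * s\<^sup>2 / 8\<close>.\<close>
  define s where "s = 4 * \<mu> / real T"
  have one_sided: "measure_pmf.prob (P T) {x. \<exists>k\<le>T. \<mu> \<le> \<sigma> * Z k x} \<le> exp (- 2 * \<mu>\<^sup>2 / real T)"
    if \<sigma>: "\<bar>\<sigma>\<bar> = 1" for \<sigma>
  proof -
    have "measure_pmf.prob (P T) {x. \<exists>k\<le>T. \<mu> \<le> \<sigma> * Z k x} \<le> exp (- s * \<mu> + real T * (s\<^sup>2 / 8))"
    proof (rule pmf_chain_maximal_exp[where K = K])
      show "\<sigma> * Z 0 x = 0" if "x \<in> set_pmf (P 0)" for x using that by (simp add: Z_def M_0)
      have Z_adapted: "Z k x' = Z k x" if "x \<in> set_pmf (P n)" "x' \<in> set_pmf (K n x)" "k \<le> n" for n k x x'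
        using adapted[OF that(1,2)] that(3) by (auto simp: Z_def intro!: sum.cong)
      then show "\<sigma> * Z k x' = \<sigma> * Z k x"
        if "x \<in> set_pmf (P n)" "x' \<in> set_pmf (K n x)" "k \<le> n" for n k x x'
        using that by metis
      show "(\<integral>\<^sup>+x'. ennreal (exp (s * (\<sigma> * Z (Suc n) x' - \<sigma> * Z n x))) \<partial>K n x) \<le> ennreal (exp (s\<^sup>2 / 8))"
        if x: "x \<in> set_pmf (P n)" for n x
      proof -
        let ?m = "M n x"
        let ?p = "p ?m"
        define g where "g = (\<lambda>m'. ennreal (exp (s * \<sigma> * (real m' - real ?m - ?p))))"
        have "(\<integral>\<^sup>+x'. ennreal (exp (s * (\<sigma> * Z (Suc n) x' - \<sigma> * Z n x))) \<partial>K n x)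
            = (\<integral>\<^sup>+x'. g (M (Suc n) x') \<partial>K n x)"
        proof (intro nn_integral_cong_AE, unfold AE_measure_pmf_iff, intro ballI)
          fix x' assume x': "x' \<in> set_pmf (K n x)"
          have "Z (Suc n) x' - Z n x = real (M (Suc n) x') - real ?m - ?p"
            using adapted[OF x x'] by (simp add: Z_def)
          then show "ennreal (exp (s * (\<sigma> * Z (Suc n) x' - \<sigma> * Z n x))) = g (M (Suc n) x')"
            unfolding g_def by (metis mult.assoc right_diff_distrib)
        qed
        also have "\<dots> = (\<integral>\<^sup>+m'. g m' \<partial>map_pmf (M (Suc n)) (K n x))"
          by simp
        also have "\<dots> = (\<integral>\<^sup>+X. g (?m + of_bool X) \<partial>bernoulli_pmf ?p)"
          by (simp add: step[OF x])
        also have "\<dots> = ennreal (?p * exp (s * \<sigma> * (1 - ?p)) + (1 - ?p) * exp (- (s * \<sigma>) * ?p))"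
          using p[OF x] by (simp add: g_def ennreal_plus flip: ennreal_mult')
            (simp add: mult.commute)
        also have "\<dots> \<le> ennreal (exp ((s * \<sigma>)\<^sup>2 / 8))"
          using bernoulli_mgf_le[of ?p "s * \<sigma>"] p[OF x] by (intro ennreal_leI) auto
        also have "(s * \<sigma>)\<^sup>2 = s\<^sup>2"
          using \<sigma> by (metis mult.right_neutral power2_abs power_mult_distrib power_one)
        finally show ?thesis .
      qed
    qed (use \<mu> in \<open>auto simp: s_def P_Suc\<close>)
    also have "- s * \<mu> + real T * (s\<^sup>2 / 8) = - 2 * \<mu>\<^sup>2 / real T"
      using T by (simp add: s_def power2_eq_square field_simps)
    finally show ?thesis .
  qed
  have "{x. \<exists>k\<le>T. \<mu> \<le> \<bar>Z k x\<bar>} = {x. \<exists>k\<le>T. \<mu> \<le> 1 * Z k x} \<union> {x. \<exists>k\<le>T. \<mu> \<le> (- 1) * Z k x}"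
    by (auto simp: abs_if)
  then have "measure_pmf.prob (P T) {x. \<exists>k\<le>T. \<mu> \<le> \<bar>Z k x\<bar>}
      \<le> measure_pmf.prob (P T) {x. \<exists>k\<le>T. \<mu> \<le> 1 * Z k x}
        + measure_pmf.prob (P T) {x. \<exists>k\<le>T. \<mu> \<le> (- 1) * Z k x}"
    by (simp only: measure_Un_le sets_measure_pmf UNIV_I)
  also have "\<dots> \<le> 2 * exp (- 2 * \<mu>\<^sup>2 / real T)"
    using one_sided[of 1] one_sided[of "- 1"] by simp
  finally show ?thesis by (simp add: Z_def)
qed

subsection \<open>The number of matched nodes as a Markov chain\<close>

lemma bool_pmf_eq_bernoulli:
  assumes "pmf M True = p"
  shows "M = bernoulli_pmf p"
proof (rule pmf_eqI)
  have "sum (pmf M) UNIV = 1" by (rule sum_pmf_eq_1) auto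
  then have "pmf M True + pmf M False = 1" by (simp add: UNIV_bool)
  moreover have "0 \<le> p" "p \<le> 1" using assms by (auto simp: pmf_le_1)
  ultimately show "pmf M x = pmf (bernoulli_pmf p) x" for x
    using assms by (cases x) auto
qed

definition online_edges ::
    "nat \<Rightarrow> (nat \<Rightarrow> nat) \<Rightarrow> (nat \<Rightarrow> nat \<Rightarrow> real) \<Rightarrow> nat \<Rightarrow> nat \<Rightarrow> (nat \<times> nat \<Rightarrow> bool) pmf" where
  "online_edges N cls a t d =
     Pi_pmf ({1..N} \<times> {t}) False (\<lambda>(u, _). bernoulli_pmf (edge_prob N a (cls u) d))"

text \<open>The matching rule of \<open>myopic_run\<close> once the offline class is chosen,
  isolated because it sees the graph only through the edges at \<open>t\<close>.\<close>

definition assign ::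
    "nat \<Rightarrow> (nat \<Rightarrow> nat) \<Rightarrow> (nat \<times> nat \<Rightarrow> bool) \<Rightarrow> nat \<Rightarrow> (nat \<Rightarrow> nat option) \<Rightarrow> nat \<Rightarrow>
     (nat \<Rightarrow> nat option) pmf" where
  "assign N cls G t m c =
     (let F = free_neighbours N cls G c t m in
      if F = {} then return_pmf m else map_pmf (\<lambda>u. m(t \<mapsto> u)) (pmf_of_set F))"

text \<open>By deferred decisions, the class and the edges of node \<open>t\<close> can be drawn on its arrival.\<close>

definition myopic_step ::
    "nat \<Rightarrow> nat \<Rightarrow> (nat \<Rightarrow> nat) \<Rightarrow> nat pmf \<Rightarrow> (nat \<Rightarrow> nat \<Rightarrow> real) \<Rightarrow> (nat \<Rightarrow> nat \<Rightarrow> real) \<Rightarrow>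
     nat \<Rightarrow> (nat \<Rightarrow> nat option) \<Rightarrow> (nat \<Rightarrow> nat option) pmf" where
  "myopic_step N C cls \<nu> a Q t m =
     bind_pmf \<nu> (\<lambda>d. bind_pmf (online_edges N cls a t d) (\<lambda>G.
     bind_pmf (class_choice C \<nu> Q d) (assign N cls G t m)))"

section \<open>Deferred decisions: the matching as a Markov chain\<close>

lemma assign_cong:
  assumes "\<And>u. u \<in> {1..N} \<Longrightarrow> G (u, t) = G' (u, t)"
  shows "assign N cls G t m c = assign N cls G' t m c"
proof -
  have "free_neighbours N cls G c t m = free_neighbours N cls G' c t m"
    using assms by (auto simp: free_neighbours_def)
  then show ?thesis by (simp add: assign_def)
qed

lemma myopic_run_Suc:
  "myopic_run N C cls \<nu> Q d G (Suc n) =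
     bind_pmf (myopic_run N C cls \<nu> Q d G n) (\<lambda>m.
     bind_pmf (class_choice C \<nu> Q (d (Suc n))) (assign N cls G (Suc n) m))"
  by (simp add: assign_def[abs_def])

lemma myopic_run_cong:
  assumes "\<And>t. t \<in> {1..n} \<Longrightarrow> d t = d' t"
    and "\<And>u t. u \<in> {1..N} \<Longrightarrow> t \<in> {1..n} \<Longrightarrow> G (u, t) = G' (u, t)"
  shows "myopic_run N C cls \<nu> Q d G n = myopic_run N C cls \<nu> Q d' G' n"
  using assms
proof (induction n)
  case (Suc n)
  have "assign N cls G (Suc n) m c = assign N cls G' (Suc n) m c" for m c
    using Suc.prems(2) by (intro assign_cong) auto
  then have "assign N cls G (Suc n) m = assign N cls G' (Suc n) m" for m by (rule ext)
  moreover have "myopic_run N C cls \<nu> Q d G n = myopic_run N C cls \<nu> Q d' G' n"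
    using Suc.prems by (intro Suc.IH) auto
  ultimately show ?case using Suc.prems(1)[of "Suc n"] by (simp only: myopic_run_Suc) simp
qed simp

text \<open>Changing the class of node \<open>Suc T\<close> alters only the laws of its own edges,
  so the product law splits into the old edges and an independent family of new ones.\<close>

lemma sbm_edges_Suc:
  "Pi_pmf ({1..N} \<times> {1..Suc T}) False
       (\<lambda>(u, t). bernoulli_pmf (edge_prob N a (cls u) ((d(Suc T := x)) t))) =
   bind_pmf (Pi_pmf ({1..N} \<times> {1..T}) False (\<lambda>(u, t). bernoulli_pmf (edge_prob N a (cls u) (d t)))) (\<lambda>G.
   bind_pmf (online_edges N cls a (Suc T) x) (\<lambda>H.
   return_pmf (\<lambda>e. if e \<in> {1..N} \<times> {1..T} then G e else H e)))"
proof -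
  let ?p = "\<lambda>d (u, t). bernoulli_pmf (edge_prob N a (cls u) (d t))"
  let ?A = "{1..N} \<times> {1..T}" and ?B = "{1..N} \<times> {Suc T}"
  have "{1..N} \<times> {1..Suc T} = ?A \<union> ?B" by auto
  then have "Pi_pmf ({1..N} \<times> {1..Suc T}) False (?p (d(Suc T := x)))
      = map_pmf (\<lambda>(f, g) e. if e \<in> ?A then f e else g e)
          (pair_pmf (Pi_pmf ?A False (?p (d(Suc T := x)))) (Pi_pmf ?B False (?p (d(Suc T := x)))))"
    by (simp only:) (rule Pi_pmf_union; auto)
  also have "Pi_pmf ?A False (?p (d(Suc T := x))) = Pi_pmf ?A False (?p d)"
    by (intro Pi_pmf_cong) auto
  also have "Pi_pmf ?B False (?p (d(Suc T := x))) = online_edges N cls a (Suc T) x"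
    unfolding online_edges_def by (intro Pi_pmf_cong) auto
  finally show ?thesis
    by (simp add: map_pmf_def pair_pmf_def bind_assoc_pmf bind_return_pmf)
qed

lemma myopic_pmf_0: "myopic_pmf N 0 C cls \<nu> a Q = return_pmf Map.empty"
  by (simp add: myopic_pmf_def split_def)

text \<open>The first \<open>T\<close> steps read neither the class nor the edges of node
  \<open>Suc T\<close>, so both draws can be postponed until after those steps.\<close>

lemma myopic_pmf_Suc:
  "myopic_pmf N (Suc T) C cls \<nu> a Q =
     bind_pmf (myopic_pmf N T C cls \<nu> a Q) (myopic_step N C cls \<nu> a Q (Suc T))"
proof -
  let ?P = "Pi_pmf {1..T} 0 (\<lambda>_. \<nu>)"
  let ?E = "\<lambda>d. Pi_pmf ({1..N} \<times> {1..T}) False (\<lambda>(u, t). bernoulli_pmf (edge_prob N a (cls u) (d t)))"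
  let ?O = "online_edges N cls a (Suc T)"
  let ?run = "\<lambda>d G. myopic_run N C cls \<nu> Q d G T"
  let ?new = "\<lambda>x H m. bind_pmf (class_choice C \<nu> Q x) (assign N cls H (Suc T) m)"
  have run: "myopic_run N C cls \<nu> Q (d(Suc T := x)) (\<lambda>e. if e \<in> {1..N} \<times> {1..T} then G e else H e) (Suc T)
      = bind_pmf (?run d G) (?new x H)" (is "myopic_run _ _ _ _ _ ?d ?G _ = _") for d x G H
  proof -
    have "myopic_run N C cls \<nu> Q ?d ?G T = ?run d G"
      by (intro myopic_run_cong) auto
    moreover have "assign N cls ?G (Suc T) m = assign N cls H (Suc T) m" for m
      by (intro ext assign_cong) auto
    ultimately show ?thesis by (simp only: myopic_run_Suc fun_upd_same)
  qed
  have "{1..Suc T} = insert (Suc T) {1..T}" by auto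
  then have classes: "Pi_pmf {1..Suc T} 0 (\<lambda>_. \<nu>)
      = bind_pmf \<nu> (\<lambda>x. bind_pmf ?P (\<lambda>d. return_pmf (d(Suc T := x))))"
    by (simp only:) (rule Pi_pmf_insert'; simp)
  have "myopic_pmf N (Suc T) C cls \<nu> a Q
      = bind_pmf \<nu> (\<lambda>x. bind_pmf ?P (\<lambda>d. bind_pmf (?E d) (\<lambda>G. bind_pmf (?O x) (\<lambda>H.
          bind_pmf (?run d G) (?new x H)))))"
    unfolding myopic_pmf_def sbm_pmf_def classes
    by (simp only: bind_assoc_pmf bind_return_pmf sbm_edges_Suc run prod.case)
  \<comment> \<open>The class draw \<open>x\<close> moves inward past the old classes and edges;
    then the edge draw \<open>H\<close> and finally \<open>x\<close> move past the run.\<close>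
  also have "\<dots> = bind_pmf ?P (\<lambda>d. bind_pmf \<nu> (\<lambda>x. bind_pmf (?E d) (\<lambda>G. bind_pmf (?O x) (\<lambda>H.
          bind_pmf (?run d G) (?new x H)))))"
    by (rule bind_commute_pmf)
  also have "\<dots> = bind_pmf ?P (\<lambda>d. bind_pmf (?E d) (\<lambda>G. bind_pmf \<nu> (\<lambda>x. bind_pmf (?O x) (\<lambda>H.
          bind_pmf (?run d G) (?new x H)))))"
    by (intro bind_pmf_cong refl bind_commute_pmf)
  also have "\<dots> = bind_pmf ?P (\<lambda>d. bind_pmf (?E d) (\<lambda>G. bind_pmf \<nu> (\<lambda>x. bind_pmf (?run d G) (\<lambda>m.
          bind_pmf (?O x) (\<lambda>H. ?new x H m)))))"
    by (intro bind_pmf_cong refl bind_commute_pmf)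
  also have "\<dots> = bind_pmf ?P (\<lambda>d. bind_pmf (?E d) (\<lambda>G. bind_pmf (?run d G) (\<lambda>m. bind_pmf \<nu> (\<lambda>x.
          bind_pmf (?O x) (\<lambda>H. ?new x H m)))))"
    by (intro bind_pmf_cong refl bind_commute_pmf)
  also have "\<dots> = bind_pmf (myopic_pmf N T C cls \<nu> a Q) (myopic_step N C cls \<nu> a Q (Suc T))"
    unfolding myopic_pmf_def sbm_pmf_def myopic_step_def[abs_def]
    by (simp only: bind_assoc_pmf bind_return_pmf prod.case)
  finally show ?thesis .
qed

section \<open>Effect of one arrival on the counts\<close>

lemma matched_before_upd:
  "s \<le> t \<Longrightarrow> matched_before (m(t \<mapsto> u)) s = matched_before m s"
  "matched_before (m(t \<mapsto> u)) (Suc t) = insert u (matched_before m t)"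
  by (auto simp: matched_before_def less_Suc_eq) (metis leD)

lemma matched_before_Suc_None:
  "m t = None \<Longrightarrow> matched_before m (Suc t) = matched_before m t"
  by (auto simp: matched_before_def less_Suc_eq)

lemma num_matched_upd:
  assumes "u \<in> {1..N}" "u \<notin> matched_before m t"
  shows "num_matched N cls c (Suc t) (m(t \<mapsto> u)) = num_matched N cls c t m + of_bool (cls u = c)"
proof -
  let ?S = "{v \<in> {1..N}. cls v = c \<and> v \<in> matched_before m t}"
  have "{v \<in> {1..N}. cls v = c \<and> v \<in> matched_before (m(t \<mapsto> u)) (Suc t)}
      = (if cls u = c then insert u ?S else ?S)"
    using assms by (auto simp: matched_before_upd)
  moreover have "u \<notin> ?S" using assms by simp
  ultimately show ?thesis by (simp add: num_matched_def)
qed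

lemma set_pmf_assign:
  assumes "m' \<in> set_pmf (assign N cls G t m c)"
  shows "m' = m \<or> (\<exists>u. m' = m(t \<mapsto> u))"
proof -
  have "finite (free_neighbours N cls G c t m)" by (simp add: free_neighbours_def)
  then show ?thesis using assms by (auto simp: assign_def Let_def split: if_splits)
qed

lemma set_pmf_myopic_step:
  assumes "m' \<in> set_pmf (myopic_step N C cls \<nu> a Q t m)"
  shows "m' = m \<or> (\<exists>u. m' = m(t \<mapsto> u))"
proof -
  obtain d G c where "m' \<in> set_pmf (assign N cls G t m c)"
    using assms by (auto simp: myopic_step_def)
  then show ?thesis by (rule set_pmf_assign)
qed

text \<open>Used when an arrival stays unmatched: since it has no entry from before, the set of
  matched nodes does not change.\<close>

lemma myopic_pmf_unmatched:
  assumes "m \<in> set_pmf (myopic_pmf N T C cls \<nu> a Q)" "T < t"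
  shows "m t = None"
  using assms
proof (induction T arbitrary: m)
  case (Suc T)
  then obtain m0 where "m0 \<in> set_pmf (myopic_pmf N T C cls \<nu> a Q)"
      "m \<in> set_pmf (myopic_step N C cls \<nu> a Q (Suc T) m0)"
    by (auto simp: myopic_pmf_Suc)
  then show ?case using Suc set_pmf_myopic_step[of m] by (metis Suc_lessD fun_upd_other less_irrefl)
qed (simp add: myopic_pmf_0)

lemma num_matched_myopic_step:
  assumes "m' \<in> set_pmf (myopic_step N C cls \<nu> a Q t m)" "s \<le> t"
  shows "num_matched N cls c s m' = num_matched N cls c s m"
  using set_pmf_myopic_step[OF assms(1)] matched_before_upd(1)[OF assms(2)]
  by (auto simp: num_matched_def)

text \<open>Every free neighbour of the chosen class would add exactly one node of that class, so
  the uniform choice among them does not influence the counts.\<close>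

lemma num_matched_assign:
  assumes "m t = None"
  shows "map_pmf (num_matched N cls c (Suc t)) (assign N cls G t m c') =
    return_pmf (num_matched N cls c t m + of_bool (c' = c \<and> free_neighbours N cls G c t m \<noteq> {}))"
proof (cases "free_neighbours N cls G c' t m = {}")
  case True
  then show ?thesis
    using assms by (auto simp: assign_def num_matched_def matched_before_Suc_None)
next
  case False
  let ?F = "free_neighbours N cls G c' t m"
  have fin: "finite ?F" by (simp add: free_neighbours_def)
  have "map_pmf (num_matched N cls c (Suc t)) (assign N cls G t m c')
      = map_pmf (\<lambda>u. num_matched N cls c (Suc t) (m(t \<mapsto> u))) (pmf_of_set ?F)"
    using False by (simp add: assign_def pmf.map_comp o_def)
  also have "\<dots> = map_pmf (\<lambda>u. num_matched N cls c t m + of_bool (c' = c)) (pmf_of_set ?F)"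
    using False fin
    by (intro map_pmf_cong refl, subst num_matched_upd) (auto simp: free_neighbours_def)
  finally show ?thesis using False by (auto simp: map_pmf_const)
qed

text \<open>The event is a product event: the edges from \<open>t\<close> to unmatched nodes of
  class \<open>c\<close> are absent, and every other coordinate is free and contributes a factor
  \<open>1\<close>.\<close>

lemma prob_no_free_neighbour:
  assumes "edge_prob N a c d \<in> {0..1}"
  shows "measure_pmf.prob (online_edges N cls a t d) {G. free_neighbours N cls G c t m = {}}
    = (1 - edge_prob N a c d) ^ (card {u \<in> {1..N}. cls u = c} - num_matched N cls c t m)"
proof -
  let ?A = "{1..N} \<times> {t}"
  let ?B = "\<lambda>(u, s :: nat). if cls u = c \<and> u \<notin> matched_before m t then {False} else UNIV"
  let ?S = "{u \<in> {1..N}. cls u = c}" and ?M = "{u \<in> {1..N}. cls u = c \<and> u \<in> matched_before m t}"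
  have "{G. free_neighbours N cls G c t m = {}} = Pi ?A ?B"
    by (auto simp: free_neighbours_def Pi_def split: if_splits)
  then have "measure_pmf.prob (online_edges N cls a t d) {G. free_neighbours N cls G c t m = {}}
      = (\<Prod>x\<in>?A. measure_pmf.prob (case x of (u, _) \<Rightarrow> bernoulli_pmf (edge_prob N a (cls u) d)) (?B x))"
    unfolding online_edges_def by (simp only:) (rule measure_Pi_pmf_Pi; simp)
  also have "\<dots> = (\<Prod>(u, s)\<in>?A. if u \<in> ?S - ?M then 1 - edge_prob N a c d else 1)"
    using assms by (intro prod.cong refl) (auto simp: measure_pmf_single)
  also have "\<dots> = (\<Prod>u\<in>{1..N}. if u \<in> ?S - ?M then 1 - edge_prob N a c d else 1)"
    by (subst prod.cartesian_product[symmetric]) simp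
  also have "\<dots> = (\<Prod>u\<in>{1..N} \<inter> (?S - ?M). 1 - edge_prob N a c d)"
    by (rule prod.inter_restrict[symmetric]) simp
  also have "{1..N} \<inter> (?S - ?M) = ?S - ?M" by auto
  also have "(\<Prod>u\<in>?S - ?M. 1 - edge_prob N a c d) = (1 - edge_prob N a c d) ^ card (?S - ?M)"
    by simp
  also have "card (?S - ?M) = card ?S - card ?M"
    by (rule card_Diff_subset) auto
  finally show ?thesis by (simp add: num_matched_def)
qed

text \<open>The count rises exactly when the chosen class is \<open>c\<close> and a free neighbour
  of that class exists. Given \<open>d\<close> the choice and the edges are independent, and
  averaging over \<open>d\<close> cancels \<open>pmf \<nu> d\<close>; the result depends on
  \<open>m\<close> only through the count.\<close>

lemma num_matched_step_law:
  fixes cls :: "nat \<Rightarrow> nat"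
  assumes Q: "Q \<in> transport_plans C D b \<nu>" and \<nu>: "set_pmf \<nu> \<subseteq> {1..D}" and c: "c \<in> {1..C}"
    and edge: "\<And>d. d \<in> {1..D} \<Longrightarrow> edge_prob N a c d \<in> {0..1}"
    and None: "m t = None"
  defines "p \<equiv> match_prob N D (a c) (Q c) (card {u \<in> {1..N}. cls u = c}) (num_matched N cls c t m)"
  shows "map_pmf (num_matched N cls c (Suc t)) (myopic_step N C cls \<nu> a Q t m)
      = map_pmf (\<lambda>X. num_matched N cls c t m + of_bool X) (bernoulli_pmf p)"
    and "p \<in> {0..1}"
proof -
  let ?k = "num_matched N cls c t m"
  let ?free = "\<lambda>G. free_neighbours N cls G c t m \<noteq> {}"
  let ?B = "\<lambda>d. bind_pmf (online_edges N cls a t d) (\<lambda>G.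
    map_pmf (\<lambda>c'. c' = c \<and> ?free G) (class_choice C \<nu> Q d))"
  define B where "B = bind_pmf \<nu> ?B"
  have "map_pmf (num_matched N cls c (Suc t)) (myopic_step N C cls \<nu> a Q t m)
      = map_pmf (\<lambda>X. ?k + of_bool X) B"
    unfolding myopic_step_def B_def map_bind_pmf num_matched_assign[of m, OF None]
    by (simp only: pmf.map_comp o_def) (simp only: map_pmf_def)
  moreover have B_True: "pmf B True = p"
  proof -
    have inner: "pmf (?B d) True
        = Q c d / pmf \<nu> d * (1 - (1 - a c d / real N) ^ (card {u \<in> {1..N}. cls u = c} - ?k))"
      if d: "d \<in> set_pmf \<nu>" for d
    proof -
      have dD: "d \<in> {1..D}" using d \<nu> by auto
      have "pmf (map_pmf (\<lambda>c'. c' = c \<and> ?free G) (class_choice C \<nu> Q d)) True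
          = Q c d / pmf \<nu> d * indicator {G. ?free G} G" for G
      proof -
        have "(\<lambda>c'. c' = c \<and> ?free G) -` {True} = (if ?free G then {c} else {})" by auto
        then show ?thesis
          using pmf_class_choice[OF Q dD d, of c] c by (simp add: pmf_map measure_pmf_single)
      qed
      then have "pmf (?B d) True
          = Q c d / pmf \<nu> d * measure_pmf.prob (online_edges N cls a t d) {G. ?free G}"
        by (simp add: pmf_bind)
      also have "{G. ?free G} = UNIV - {G. free_neighbours N cls G c t m = {}}" by auto
      also have "measure_pmf.prob (online_edges N cls a t d) \<dots>
          = 1 - (1 - edge_prob N a c d) ^ (card {u \<in> {1..N}. cls u = c} - ?k)"
        using measure_pmf.prob_compl[of "{G. free_neighbours N cls G c t m = {}}" "online_edges N cls a t d"]
        by (simp add: prob_no_free_neighbour[OF edge[OF dD]])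
      finally show ?thesis by (simp add: edge_prob_def)
    qed
    have "pmf B True = (\<Sum>d\<in>{1..D}. pmf (?B d) True * pmf \<nu> d)"
      unfolding B_def by (subst pmf_bind, subst integral_measure_pmf_real[where A = "{1..D}"]) (use \<nu> in auto)
    also have "\<dots> = p"
      unfolding p_def match_prob_def
    proof (intro sum.cong refl)
      fix d assume d: "d \<in> {1..D}"
      show "pmf (?B d) True * pmf \<nu> d
        = Q c d * (1 - (1 - a c d / real N) ^ (card {u \<in> {1..N}. cls u = c} - ?k))"
      proof (cases "d \<in> set_pmf \<nu>")
        case True
        then show ?thesis by (simp add: inner[OF True] set_pmf_iff)
      next
        \<comment> \<open>Here \<open>class_choice\<close> carries no guarantee, but the nonnegative
          entries of column \<open>d\<close> sum to \<open>pmf \<nu> d = 0\<close>, which forces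
          \<open>Q c d = 0\<close>; both sides vanish.\<close>
        case False
        then have "(\<Sum>c=1..C. Q c d) = 0" "\<And>c. c \<in> {1..C} \<Longrightarrow> 0 \<le> Q c d"
          using Q d by (auto simp: transport_plans_def set_pmf_iff)
        then have "Q c d = 0"
          using c sum_nonneg_eq_0_iff[of "{1..C}" "\<lambda>c. Q c d"] by blast
        then show ?thesis using False by (simp add: set_pmf_iff)
      qed
    qed
    finally show ?thesis .
  qed
  then have "B = bernoulli_pmf p" by (rule bool_pmf_eq_bernoulli)
  ultimately show "map_pmf (num_matched N cls c (Suc t)) (myopic_step N C cls \<nu> a Q t m)
      = map_pmf (\<lambda>X. ?k + of_bool X) (bernoulli_pmf p)" by simp
  show "p \<in> {0..1}" using B_True by (auto simp: pmf_le_1)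
qed

subsection \<open>Concentration around the solution\<close>

text \<open>The index is shifted because \<open>num_matched\<close> at \<open>Suc k\<close> counts
  what was matched before node \<open>Suc k\<close>, that is, after \<open>k\<close> steps of the
  chain.\<close>

lemma num_matched_deviation:
  fixes cls :: "nat \<Rightarrow> nat"
  assumes Q: "Q \<in> transport_plans C D b \<nu>" and \<nu>: "set_pmf \<nu> \<subseteq> {1..D}" and c: "c \<in> {1..C}"
    and edge: "\<And>d. d \<in> {1..D} \<Longrightarrow> edge_prob N a c d \<in> {0..1}"
    and \<mu>: "0 < \<mu>" and T: "0 < T"
  defines "p \<equiv> match_prob N D (a c) (Q c) (card {u \<in> {1..N}. cls u = c})"
  shows "measure_pmf.prob (myopic_pmf N T C cls \<nu> a Q)
      {m. \<exists>k\<le>T. \<mu> \<le> \<bar>real (num_matched N cls c (Suc k) m) - (\<Sum>j<k. p (num_matched N cls c (Suc j) m))\<bar>}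
    \<le> 2 * exp (- 2 * \<mu>\<^sup>2 / real T)"
proof (rule pmf_chain_count_deviation[where P = "\<lambda>n. myopic_pmf N n C cls \<nu> a Q"
      and K = "\<lambda>n. myopic_step N C cls \<nu> a Q (Suc n)" and M = "\<lambda>k. num_matched N cls c (Suc k)"])
  show "num_matched N cls c (Suc 0) m = 0" if "m \<in> set_pmf (myopic_pmf N 0 C cls \<nu> a Q)" for m
    using that by (simp add: myopic_pmf_0 num_matched_def matched_before_def)
  show "num_matched N cls c (Suc k) m' = num_matched N cls c (Suc k) m"
    if "m' \<in> set_pmf (myopic_step N C cls \<nu> a Q (Suc n) m)" "k \<le> n" for n k m m'
    using that by (intro num_matched_myopic_step) auto
next
  fix n m assume "m \<in> set_pmf (myopic_pmf N n C cls \<nu> a Q)"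
  then have None: "m (Suc n) = None" by (rule myopic_pmf_unmatched) simp
  note law = num_matched_step_law[where a = a and c = c and m = m and t = "Suc n" and cls = cls,
      OF Q \<nu> c edge None, folded p_def]
  show "map_pmf (num_matched N cls c (Suc (Suc n))) (myopic_step N C cls \<nu> a Q (Suc n) m)
      = map_pmf (\<lambda>X. num_matched N cls c (Suc n) m + of_bool X) (bernoulli_pmf (p (num_matched N cls c (Suc n) m)))"
    by (rule law(1))
  show "p (num_matched N cls c (Suc n) m) \<in> {0..1}"
    by (rule law(2))
qed (use \<mu> T myopic_pmf_Suc in auto)

lemma class_prop_bounds: "0 \<le> class_prop N cls c" "class_prop N cls c \<le> 1"
proof -
  have "card {u \<in> {1..N}. cls u = c} \<le> card {1..N}" by (intro card_mono) auto
  then show "0 \<le> class_prop N cls c" "class_prop N cls c \<le> 1"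
    by (auto simp: class_prop_def divide_simps)
qed

text \<open>Here \<open>r\<close> is the cube root of \<open>N\<close>, and
  \<open>4 * \<alpha> < r * L\<^sup>2\<close> is what positivity of the claimed probability
  provides. The budget \<open>3 * L / r\<close> is spent as \<open>L / (2 * r)\<close>,
  \<open>2 * L / r\<close> and \<open>L / (2 * r)\<close>.\<close>

lemma tracking_error_le:
  fixes N \<alpha> L r :: real
  assumes r: "1 \<le> r" "r ^ 3 = N" and \<alpha>: "1 \<le> \<alpha> * N" and L: "0 \<le> L" "4 * \<alpha> < r * L\<^sup>2"
  shows "0 < L" and "L / (2 * r) + 2 * L / N + 1 / (2 * N) \<le> 3 * L / r"
proof -
  have "0 < N" using r by auto
  with \<alpha> have "0 < \<alpha>" by (metis less_le_trans zero_less_mult_pos2 zero_less_one)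
  then show "0 < L" using L by (cases "L = 0") auto
  \<comment> \<open>Multiplying \<open>4 * \<alpha> < r * L\<^sup>2\<close> by
    \<open>N = r ^ 3\<close> and using \<open>1 \<le> \<alpha> * N\<close> bounds \<open>L\<close>
    below by \<open>1 / r\<^sup>2\<close>, which is what the term \<open>1 / (2 * N)\<close>
    requires.\<close>
  have "1 \<le> (r\<^sup>2 * L)\<^sup>2"
  proof -
    have "4 * (\<alpha> * N) \<le> r * L\<^sup>2 * N" using L r by auto
    also have "\<dots> = (r\<^sup>2 * L)\<^sup>2" by (simp add: r(2)[symmetric] power_mult_distrib power_numeral_reduce)
    finally show ?thesis using \<alpha> by linarith
  qed
  then have "1 \<le> r\<^sup>2 * L"
    using L(1) r(1) by (metis abs_1 abs_of_nonneg abs_le_square_iff mult_nonneg_nonneg power_one zero_le_power2)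
  then have "1 / (2 * N) \<le> L / (2 * r)"
    using r by (simp add: r(2)[symmetric] field_simps power2_eq_square power3_eq_cube)
  moreover have "2 * L / N \<le> 2 * L / r"
  proof (rule divide_left_mono)
    show "r \<le> N" using self_le_power[of r 3] r by simp
  qed (use L r in auto)
  ultimately show "L / (2 * r) + 2 * L / N + 1 / (2 * N) \<le> 3 * L / r"
    by (simp add: field_simps)
qed

lemma num_matched_concentration:
  fixes cls :: "nat \<Rightarrow> nat"
  assumes Q: "Q \<in> transport_plans C D (class_prop N cls) \<nu>" and \<nu>: "set_pmf \<nu> \<subseteq> {1..D}"
    and c: "c \<in> {1..C}" and N: "0 < N" and T: "0 < T" "real T = \<alpha> * real N"
    and a_le: "\<And>d. d \<in> {1..D} \<Longrightarrow> a c d \<le> real N"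
    and sol: "fluid_solution D (a c) (Q c) (class_prop N cls c) \<alpha> z"
  defines "\<Lambda> \<equiv> rate_L D a Q c"
  shows "1 - 2 * real C * exp (- (real N powr (1/3) * \<Lambda>\<^sup>2 / (8 * \<alpha>)))
    \<le> measure_pmf.prob (myopic_pmf N T C cls \<nu> a Q)
        {m. \<forall>t\<in>{1..T}. \<bar>real (num_matched N cls c t m) / real N - z (real t / real N)\<bar>
          \<le> 3 * \<Lambda> * exp (\<alpha> * \<Lambda>) / real N powr (1/3)}"
    (is "1 - 2 * real C * exp (- ?e) \<le> measure_pmf.prob ?P ?good")
proof (cases "1 - 2 * real C * exp (- ?e) \<le> 0")
  case True
  then show ?thesis by (meson measure_nonneg order_trans)
next
  case False
  interpret fluid_solution D "a c" "Q c" "class_prop N cls c" \<alpha> z by (rule sol)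
  have L_eq: "L = \<Lambda>"
    by (simp add: \<Lambda>_def L_def rate_L_def)
  have C: "1 \<le> real C" using c by simp
  define r where "r = real N powr (1/3)"
  have r: "1 \<le> r" "r ^ 3 = real N"
    using N by (auto simp: r_def powr_powr ge_one_powr_ge_zero simp flip: powr_realpow)
  \<comment> \<open>Positivity of the bound gives \<open>exp (- ?e) < 1 / 2\<close>, and
    \<open>1 - ?e \<le> exp (- ?e)\<close> turns this into \<open>1 / 2 < ?e\<close>.\<close>
  have "4 * \<alpha> < r * \<Lambda>\<^sup>2"
  proof -
    have "exp (- ?e) \<le> real C * exp (- ?e)" using C by simp
    moreover have "1 + - ?e \<le> exp (- ?e)" by (rule exp_ge_add_one_self)
    ultimately have "1 / 2 < ?e" using False by argo
    then show ?thesis using \<alpha>_pos by (simp add: r_def field_simps)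
  qed
  moreover have "1 \<le> \<alpha> * real N" using T by simp
  moreover have "0 \<le> \<Lambda>" using L_nonneg by (simp add: L_eq)
  ultimately have \<Lambda>: "0 < \<Lambda>" "\<Lambda> / (2 * r) + 2 * \<Lambda> / real N + 1 / (2 * real N) \<le> 3 * \<Lambda> / r"
    using tracking_error_le[OF r] by blast+
  \<comment> \<open>Chosen so that \<open>\<mu> / N = \<Lambda> / (2 * r)\<close>, the first share
    of the error budget.\<close>
  define \<mu> where "\<mu> = real N * \<Lambda> / (2 * r)"
  have \<mu>: "0 < \<mu>" using N \<Lambda> r by (simp add: \<mu>_def)
  let ?n = "card {u \<in> {1..N}. cls u = c}"
  let ?dev = "\<lambda>k m. \<bar>real (num_matched N cls c (Suc k) m)
    - (\<Sum>j<k. match_prob N D (a c) (Q c) ?n (num_matched N cls c (Suc j) m))\<bar>"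
  let ?bad = "{m. \<exists>k\<le>T. \<mu> \<le> ?dev k m}"
  have "measure_pmf.prob ?P ?bad \<le> 2 * exp (- 2 * \<mu>\<^sup>2 / real T)"
  proof (rule num_matched_deviation[OF Q \<nu> c _ \<mu> T(1)])
    show "edge_prob N a c d \<in> {0..1}" if "d \<in> {1..D}" for d
      using a_le[OF that] r_nonneg[OF that] N by (simp add: edge_prob_def)
  qed
  also have "\<dots> \<le> 2 * real C * exp (- ?e)"
  proof -
    \<comment> \<open>With this \<mu> the exponent of the maximal inequality is four times the
      required one.\<close>
    have "2 * \<mu>\<^sup>2 / real T = 4 * ?e"
    proof -
      have "2 * \<mu>\<^sup>2 / real T = real N * \<Lambda>\<^sup>2 / (2 * r\<^sup>2 * \<alpha>)"
        using N \<alpha>_pos r by (simp add: \<mu>_def T(2) field_simps power2_eq_square)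
      also have "\<dots> = r * \<Lambda>\<^sup>2 / (2 * \<alpha>)"
        using r(1) by (simp add: r(2)[symmetric] field_simps power2_eq_square power3_eq_cube)
      finally show ?thesis by (simp add: r_def)
    qed
    moreover have "0 \<le> ?e" using \<alpha>_pos by simp
    ultimately have "?e \<le> 2 * \<mu>\<^sup>2 / real T" by linarith
    then have "exp (- 2 * \<mu>\<^sup>2 / real T) \<le> exp (- ?e)" by simp
    also have "\<dots> \<le> real C * exp (- ?e)" using C by simp
    finally show ?thesis by simp
  qed
  finally have bad: "measure_pmf.prob ?P ?bad \<le> 2 * real C * exp (- ?e)" .
  have "UNIV - ?bad \<subseteq> ?good"
  proof (intro subsetI CollectI ballI)
    fix m t assume m: "m \<in> UNIV - ?bad" and t: "t \<in> {1..T}"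
    have dev: "?dev k m < \<mu>" if "k \<le> T" for k
    proof (rule ccontr)
      assume "\<not> ?dev k m < \<mu>"
      then have "\<mu> \<le> ?dev k m" by (rule leI)
      with that have "\<exists>k\<le>T. \<mu> \<le> ?dev k m" by (intro exI[of _ k] conjI)
      with m show False by (simp only: Diff_iff mem_Collect_eq simp_thms)
    qed
    obtain k where k: "t = Suc k" "k < T" using t by (cases t) auto
    have "\<bar>real (num_matched N cls c (Suc k) m) / real N - z (real (Suc k) / real N)\<bar>
        \<le> (\<mu> / real N + 2 * L / real N + 1 / (2 * real N)) * exp (\<alpha> * L)"
    proof (rule chain_tracks_solution[OF N T(2), where n = ?n])
      show "real ?n = class_prop N cls c * real N" using N by (simp add: class_prop_def)
      show "num_matched N cls c (Suc k) m \<le> ?n" for k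
        unfolding num_matched_def by (intro card_mono) auto
      show "?dev k m \<le> \<mu>" if "k < T" for k
        using dev[of k] that by linarith
    qed (use \<Lambda> a_le k L_eq in auto)
    also have "\<mu> / real N = \<Lambda> / (2 * r)" using N by (simp add: \<mu>_def)
    also have "(\<Lambda> / (2 * r) + 2 * L / real N + 1 / (2 * real N)) * exp (\<alpha> * L)
        \<le> 3 * \<Lambda> / r * exp (\<alpha> * \<Lambda>)"
      unfolding L_eq using \<Lambda> by (intro mult_right_mono) auto
    finally show "\<bar>real (num_matched N cls c t m) / real N - z (real t / real N)\<bar>
        \<le> 3 * \<Lambda> * exp (\<alpha> * \<Lambda>) / real N powr (1/3)"
      by (simp add: k(1) r_def)
  qed
  then have "measure_pmf.prob ?P (UNIV - ?bad) \<le> measure_pmf.prob ?P ?good"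
    by (intro measure_pmf.finite_measure_mono) auto
  moreover have "measure_pmf.prob ?P (UNIV - ?bad) = 1 - measure_pmf.prob ?P ?bad"
    using measure_pmf.prob_compl[of ?bad ?P] by simp
  ultimately show ?thesis using bad by linarith
qed

theorem theorem1:
  fixes N T C D :: nat and \<alpha> abar :: real
    and cls :: "nat \<Rightarrow> nat" and \<nu> :: "nat pmf"
    and a Q :: "nat \<Rightarrow> nat \<Rightarrow> real" and b :: "nat \<Rightarrow> real"
    and y :: "nat \<Rightarrow> real \<Rightarrow> real"
  assumes "1 \<le> N" and "1 \<le> T" and "1 \<le> C" and "1 \<le> D"
    and "0 < \<alpha>" and "real T = \<alpha> * real N"
    and "\<forall>u\<in>{1..N}. cls u \<in> {1..C}"
    and "set_pmf \<nu> \<subseteq> {1..D}"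
    and "0 < abar" and "abar < real N"
    and "\<forall>c\<in>{1..C}. \<forall>d\<in>{1..D}. 0 \<le> a c d \<and> a c d \<le> abar"
    and "b = class_prop N cls"
    and "optimal_plan C D b \<nu> (edge_prob N a) Q"
    and "\<forall>c\<in>{1..C}. y c 0 = 0"
    and "\<forall>c\<in>{1..C}. \<forall>s\<in>{0..\<alpha>}.
           (y c has_real_derivative (\<Sum>d=1..D. (1 - exp (- a c d * (b c - y c s))) * Q c d))
             (at s within {0..\<alpha>})"
  shows "(\<forall>c\<in>{1..C}.
            measure_pmf.prob (myopic_pmf N T C cls \<nu> a Q)
              {m. \<forall>t\<in>{1..T}.
                    \<bar>real (num_matched N cls c t m) / real N - y c (real t / real N)\<bar>
                      \<le> 3 * rate_L D a Q c * exp (\<alpha> * rate_L D a Q c) / real N powr (1/3)}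
            \<ge> 1 - 2 * real C * exp (- (real N powr (1/3) * (rate_L D a Q c)\<^sup>2 / (8 * \<alpha>)))) \<and>
         (\<forall>c\<in>{1..C}. \<exists>e :: real \<Rightarrow> real.
            e 0 = 0 \<and>
            (\<forall>t\<in>{0..\<alpha>}.
               y c t = (b c - b c * exp (- t * rate_L D a Q c)) - e t \<and>
               e t \<le> (if rate_L D a Q c = 0 then 0
                      else rate_J D b a Q c / rate_L D a Q c * (1 - exp (- rate_L D a Q c * t)))) \<and>
            (rate_L D a Q c = 0 \<longrightarrow> rate_J D b a Q c = 0))"
proof -
  have Q: "Q \<in> transport_plans C D (class_prop N cls) \<nu>"
    using assms by (simp add: optimal_plan_def is_arg_max_def)
  have sol: "fluid_solution D (a c) (Q c) (class_prop N cls c) \<alpha> (y c)" if c: "c \<in> {1..C}" for c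
  proof -
    interpret fluid_limit D "a c" "Q c" "class_prop N cls c"
      using assms Q c class_prop_bounds by unfold_locales (auto simp: transport_plans_def)
    show ?thesis
      using assms c by unfold_locales (auto simp: F_def)
  qed
  show ?thesis
  proof (intro conjI ballI)
    fix c assume c: "c \<in> {1..C}"
    have a_le: "a c d \<le> real N" if "d \<in> {1..D}" for d
    proof -
      have "a c d \<le> abar" using assms(11) c that by blast
      with \<open>abar < real N\<close> show ?thesis by linarith
    qed
    show "1 - 2 * real C * exp (- (real N powr (1/3) * (rate_L D a Q c)\<^sup>2 / (8 * \<alpha>)))
      \<le> measure_pmf.prob (myopic_pmf N T C cls \<nu> a Q)
          {m. \<forall>t\<in>{1..T}. \<bar>real (num_matched N cls c t m) / real N - y c (real t / real N)\<bar>
            \<le> 3 * rate_L D a Q c * exp (\<alpha> * rate_L D a Q c) / real N powr (1/3)}"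
      by (rule num_matched_concentration[where a = a and c = c and z = "y c", OF Q _ c _ _ _ _ sol[OF c]])
        (use assms(1,2,6,8) a_le in auto)
  next
    fix c assume c: "c \<in> {1..C}"
    interpret fluid_solution D "a c" "Q c" "b c" \<alpha> "y c"
      using sol[OF c] assms by simp
    have L_eq: "L = rate_L D a Q c" by (simp add: L_def rate_L_def)
    have J_0: "rate_J D b a Q c = 0" if "rate_L D a Q c = 0"
    proof -
      \<comment> \<open>A vanishing sum of nonnegative terms has vanishing terms, so
        \<open>a c d\<close> or \<open>Q c d\<close> is zero for each \<open>d\<close>.\<close>
      have "a c d * Q c d = 0" if "d \<in> {1..D}" for d
        using \<open>rate_L D a Q c = 0\<close> r_nonneg q_nonneg that
          sum_nonneg_eq_0_iff[of "{1..D}" "\<lambda>d. a c d * Q c d"]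
        unfolding rate_L_def by simp
      then have "(a c d)\<^sup>2 * Q c d = 0" if "d \<in> {1..D}" for d
        using that by force
      then have "(\<Sum>d=1..D. (a c d)\<^sup>2 * Q c d) = 0" by (rule sum.neutral[rule_format])
      then show ?thesis by (simp only: rate_J_def mult_zero_right)
    qed
    \<comment> \<open>With the error taken as this difference the decomposition is immediate. If the
      rate is \<open>0\<close>, both functions vanish on \<open>{0..\<alpha>}\<close>.\<close>
    let ?e = "\<lambda>t. (b c - b c * exp (- t * rate_L D a Q c)) - y c t"
    have "?e t \<le> (if rate_L D a Q c = 0 then 0
        else rate_J D b a Q c / rate_L D a Q c * (1 - exp (- rate_L D a Q c * t)))"
      if t: "t \<in> {0..\<alpha>}" for t
      using linearization_error_le[OF t] y_eq_0_if_L_eq_0[OF _ t]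
      by (simp add: L_eq rate_J_def)
    then show "\<exists>e. e 0 = 0 \<and>
        (\<forall>t\<in>{0..\<alpha>}. y c t = (b c - b c * exp (- t * rate_L D a Q c)) - e t \<and>
          e t \<le> (if rate_L D a Q c = 0 then 0
            else rate_J D b a Q c / rate_L D a Q c * (1 - exp (- rate_L D a Q c * t)))) \<and>
        (rate_L D a Q c = 0 \<longrightarrow> rate_J D b a Q c = 0)"
      using J_0 y_0 by (intro exI[of _ ?e]) simp
  qed
qed

end
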